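(* Let $G$ be a profinite group. The following conditions are equivalent: (1) $G$ is covered by countably many nilpotent subgroups, that is, $G$ is the union of a countable family of nilpotent subgroups; (2) $G$ is finite-by-nilpotent, that is, $G$ has a finite normal subgroup $K$ such that $G/K$ is nilpotent; (3) there exists a positive integer $m$ such that $Z_m(G)$ is open in $G$.
   Context: $Z_m(G)$ denotes the $m$th term of the upper central series of $G$ ($Z_0(G)=1$ and $Z_{i+1}(G)/Z_i(G)=Z(G/Z_i(G))$). "Countably many" allows finitely many. The nilpotent subgroups in the cover need not have a common bound on their nilpotency classes. *)

theory Defs
  imports "HOL-Algebra.Coset" "HOL-Analysis.Analysis"
begin

definition group_center :: "('a, 'b) monoid_scheme \<Rightarrow> 'a set" where
  "group_center G =
     {z \<in> carrier G. \<forall>x \<in> carrier G. z \<otimes>\<^bsub>G\<^esub> x = x \<otimes>\<^bsub>G\<^esub> z}"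

text \<open>The term \<open>Z\<^sub>i\<^sub>+\<^sub>1\<close> is the preimage of the centre of \<open>G / Z\<^sub>i\<close> under the quotient map.\<close>

primrec upper_central :: "('a, 'b) monoid_scheme \<Rightarrow> nat \<Rightarrow> 'a set" where
  "upper_central G 0 = {\<one>\<^bsub>G\<^esub>}"
| "upper_central G (Suc i) =
     {x \<in> carrier G. upper_central G i #>\<^bsub>G\<^esub> x \<in> group_center (G Mod upper_central G i)}"

definition nilpotent_group :: "('a, 'b) monoid_scheme \<Rightarrow> bool" where
  "nilpotent_group G \<longleftrightarrow> group G \<and> (\<exists>n. upper_central G n = carrier G)"

definition totally_disconnected_space :: "'a topology \<Rightarrow> bool" where
  "totally_disconnected_space T \<longleftrightarrow> (\<forall>S. connectedin T S \<longrightarrow> (\<exists>a. S \<subseteq> {a}))"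

locale topological_group = group G for G (structure) +
  fixes T :: "'a topology"
  assumes topspace_eq_carrier: "topspace T = carrier G"
    and continuous_mult: "continuous_map (prod_topology T T) T (\<lambda>(x, y). x \<otimes> y)"
    and continuous_inv: "continuous_map T T (\<lambda>x. inv x)"

locale profinite_group = topological_group +
  assumes compact: "compact_space T"
    and Hausdorff: "Hausdorff_space T"
    and totally_disconnected: "totally_disconnected_space T"

end

theory Submission
  imports Defs "HOL-Algebra.Group_Action" "HOL-Algebra.Generated_Groups" "HOL-Algebra.Sylow"
    "HOL-Algebra.Multiplicative_Group"
begin

text \<open>
  Write \<open>[x, y] = x\<inverse> y\<inverse> x y\<close>. Everything is phrased through sets
  \<open>{x. [x, s\<^sub>1, \<dots>, s\<^sub>n] \<in> K for all s\<^sub>i \<in> S}\<close> of iterated commutators: the upper central series,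
  nilpotency of a subgroup or of a quotient, and the Engel condition \<open>[b, g, \<dots>, g] = 1\<close> are all
  inclusions between them. In a topological group, if \<open>K\<close> is closed, these sets are closed and do not
  change when \<open>S\<close> is replaced by its closure.

  From the nilpotent cover to an open term of the upper central series. By the last remark closures of
  nilpotent subgroups are nilpotent (\<open>iterated_centralizer_closure\<close>), so the subgroups of the cover may be
  taken to be closed. Baire's theorem gives an open one, hence an open normal nilpotent subgroup \<open>N\<close>. This alone is not enough, as
  the extension of the \<open>p\<close>-adic integers by an inverting involution shows, which is virtually abelian but
  infinite with trivial centre. But Baire's theorem applies to every coset \<open>N x\<close> too. It yields an open
  normal subgroup \<open>M \<subseteq> N\<close>, one for the finitely many cosets, such that each coset contains some \<open>g\<close> with
  \<open>[M, g, \<dots>, g] = 1\<close>. On the factors \<open>B = (M \<inter> Z\<^sub>i\<^sub>+\<^sub>1(N)) / (M \<inter> Z\<^sub>i(N))\<close> the subgroup \<open>N\<close> acts trivially, so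
  the finite group \<open>G / N\<close> acts and each of its elements is unipotent. If \<open>n = |G / N|\<close>, then
  unipotency together with the triviality of \<open>g\<^sup>n\<close> forces \<open>[b, g]\<close> to have bounded order
  (\<open>commutator_torsion\<close>), so the at most \<open>n\<close> elements \<open>[b, g]\<close> generate a finite normal subgroup \<open>W\<close> of bounded
  order. A group acting on a finite abelian group by unipotent automorphisms acts on the \<open>p\<close>-torsion
  through a \<open>p\<close>-group and therefore fixes a nontrivial element (\<open>unipotent_finite_abelian_meets_center\<close>);
  consequently \<open>W\<close>, and with it \<open>b\<close>, lies in a term of the upper central series of bounded index. Induction on
  \<open>i\<close> places \<open>M\<close> in some \<open>Z\<^sub>r(G)\<close>, which is then open (\<open>unipotent_nilpotent_subset_upper_central\<close>).

  From an open \<open>Z\<^sub>m(G)\<close> to finite-by-nilpotent. By compactness \<open>Z\<^sub>m(G)\<close> has finite index, and Baer's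
  theorem says that the lower central term \<open>\<gamma>\<^sub>m\<^sub>+\<^sub>1(G)\<close> is then finite. Inductively
  \<open>\<gamma>\<^sub>i\<^sub>+\<^sub>1(G)\<close> is finite modulo \<open>Z\<^sub>m\<^sub>-\<^sub>i(G)\<close>: since \<open>[\<gamma>\<^sub>i\<^sub>+\<^sub>1, Z\<^sub>m] \<subseteq> Z\<^sub>m\<^sub>-\<^sub>i\<^sub>-\<^sub>1\<close>, the next term is generated modulo
  \<open>Z\<^sub>m\<^sub>-\<^sub>i\<^sub>-\<^sub>1\<close> by finitely many commutators, and an argument in the style of Schur and Dietzmann shortens long
  products of them (\<open>finite_generate_of_shortening\<close>).

  From finite-by-nilpotent to an open term. If \<open>G / K\<close> is nilpotent of class \<open>c\<close> and the open normal subgroup \<open>N\<close>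
  meets the finite group \<open>K\<close> trivially, then \<open>[N, G, \<dots>, G] \<subseteq> N \<inter> K = 1\<close>, so \<open>N \<subseteq> Z\<^sub>c(G)\<close>.

  From an open \<open>Z\<^sub>m(G)\<close> to the cover. The preimages of the cyclic subgroups of the finite group
  \<open>G / Z\<^sub>m(G)\<close> are nilpotent of class at most \<open>m + 1\<close>, and finitely many of them cover \<open>G\<close>.
\<close>

section \<open>Iterated commutators and nilpotency\<close>

definition commutator :: "('a, 'b) monoid_scheme \<Rightarrow> 'a \<Rightarrow> 'a \<Rightarrow> 'a" where
  "commutator G x y = inv\<^bsub>G\<^esub> x \<otimes>\<^bsub>G\<^esub> inv\<^bsub>G\<^esub> y \<otimes>\<^bsub>G\<^esub> x \<otimes>\<^bsub>G\<^esub> y"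

text \<open>
  The elements \<open>x\<close> with \<open>[x, s\<^sub>1, \<dots>, s\<^sub>n] \<in> K\<close> for all \<open>s\<^sub>i \<in> S\<close>. For \<open>S = G\<close>, \<open>K = 1\<close> this is \<open>Z\<^sub>n(G)\<close>;
  a subgroup \<open>H\<close> is nilpotent if it lies in the set for \<open>S = H\<close>, \<open>K = 1\<close>; for \<open>S = {g}\<close>, \<open>K = 1\<close> it is an Engel condition,
  that is, unipotency of conjugation by \<open>g\<close>.
\<close>

primrec iterated_centralizer ::
    "('a, 'b) monoid_scheme \<Rightarrow> 'a set \<Rightarrow> 'a set \<Rightarrow> nat \<Rightarrow> 'a set" where
  "iterated_centralizer G S K 0 = K"
| "iterated_centralizer G S K (Suc n) =
     {x \<in> carrier G. \<forall>s \<in> S. commutator G x s \<in> iterated_centralizer G S K n}"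

abbreviation conjugate :: "('a, 'b) monoid_scheme \<Rightarrow> 'a \<Rightarrow> 'a \<Rightarrow> 'a" where
  "conjugate G g x \<equiv> inv\<^bsub>G\<^esub> g \<otimes>\<^bsub>G\<^esub> x \<otimes>\<^bsub>G\<^esub> g"

context group
begin

lemma mult_inv_cancel:
  assumes "x \<in> carrier G" "y \<in> carrier G"
  shows "x \<otimes> (inv x \<otimes> y) = y" "inv x \<otimes> (x \<otimes> y) = y"
  using assms by (simp_all flip: m_assoc)

text \<open>Oriented from left to right, together with the default rules, these decide the word problem of free groups.\<close>

lemmas group_word_simps = m_assoc inv_mult_group mult_inv_cancel

lemma commutator_closed [simp, intro]:
  "x \<in> carrier G \<Longrightarrow> y \<in> carrier G \<Longrightarrow> commutator G x y \<in> carrier G"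
  by (simp add: commutator_def)

lemma commutator_eq_one_iff:
  assumes "x \<in> carrier G" "y \<in> carrier G"
  shows "commutator G x y = \<one> \<longleftrightarrow> x \<otimes> y = y \<otimes> x"
proof -
  have "commutator G x y = inv (y \<otimes> x) \<otimes> (x \<otimes> y)"
    using assms by (simp add: commutator_def group_word_simps)
  then show ?thesis
    using assms by (metis inv_closed inv_inv inv_equality l_inv m_closed)
qed

lemma commutator_mult_left:
  assumes "x \<in> carrier G" "y \<in> carrier G" "s \<in> carrier G"
  shows "commutator G (x \<otimes> y) s = conjugate G y (commutator G x s) \<otimes> commutator G y s"
  using assms by (simp add: commutator_def group_word_simps)

lemma commutator_mult_right:
  assumes "x \<in> carrier G" "s \<in> carrier G" "t \<in> carrier G"
  shows "commutator G x (s \<otimes> t) = commutator G x t \<otimes> conjugate G t (commutator G x s)"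
  using assms by (simp add: commutator_def group_word_simps)

lemma commutator_inv_left:
  assumes "x \<in> carrier G" "s \<in> carrier G"
  shows "commutator G (inv x) s = conjugate G (inv x) (inv (commutator G x s))"
  using assms by (simp add: commutator_def group_word_simps)

lemma commutator_inv_right:
  assumes "x \<in> carrier G" "s \<in> carrier G"
  shows "commutator G x (inv s) = conjugate G (inv s) (inv (commutator G x s))"
  using assms by (simp add: commutator_def group_word_simps)

lemma conjugate_commutator:
  assumes "x \<in> carrier G" "s \<in> carrier G" "g \<in> carrier G"
  shows "conjugate G g (commutator G x s) = commutator G (conjugate G g x) (conjugate G g s)"
  using assms by (simp add: commutator_def group_word_simps)

lemma normalI_conjugate:
  assumes "subgroup N G" "\<And>g x. g \<in> carrier G \<Longrightarrow> x \<in> N \<Longrightarrow> conjugate G g x \<in> N"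
  shows "N \<lhd> G"
  using assms by (metis inv_closed inv_inv normal_inv_iff)

lemma normal_conjugate_closed:
  assumes "N \<lhd> G" "g \<in> carrier G" "x \<in> N"
  shows "conjugate G g x \<in> N"
  using assms by (simp add: normal.inv_op_closed1)

lemma commutator_in_normal_left:
  assumes N: "N \<lhd> G" and "x \<in> N" "g \<in> carrier G"
  shows "commutator G x g \<in> N"
proof -
  interpret N: normal N G by fact
  have "commutator G x g = inv x \<otimes> conjugate G g x"
    using assms N.subset by (simp add: commutator_def group_word_simps subset_iff)
  then show ?thesis using assms by (simp add: normal_conjugate_closed)
qed

lemma iterated_centralizer_mono:
  assumes "S' \<subseteq> S" "K \<subseteq> K'"
  shows "iterated_centralizer G S K n \<subseteq> iterated_centralizer G S' K' n"
  using assms by (induction n) auto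

lemma iterated_centralizer_add:
  "iterated_centralizer G S (iterated_centralizer G S K m) n = iterated_centralizer G S K (n + m)"
  by (induction n) auto

lemma iterated_centralizer_subset:
  "K \<subseteq> carrier G \<Longrightarrow> iterated_centralizer G S K n \<subseteq> carrier G"
  by (cases n) auto

lemma iterated_centralizer_increasing:
  assumes "K \<subseteq> carrier G" "\<And>x s. x \<in> K \<Longrightarrow> s \<in> S \<Longrightarrow> commutator G x s \<in> K" "m \<le> n"
  shows "iterated_centralizer G S K m \<subseteq> iterated_centralizer G S K n"
proof -
  have "iterated_centralizer G S K n \<subseteq> iterated_centralizer G S K (Suc n)" for n
    by (induction n) (use assms in auto)
  then show ?thesis using assms(3) by (rule lift_Suc_mono_le)
qed

lemma commutator_one_left: "s \<in> carrier G \<Longrightarrow> commutator G \<one> s = \<one>"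
  by (simp add: commutator_def)

lemma iterated_centralizer_one_increasing:
  assumes "S \<subseteq> carrier G" "m \<le> n"
  shows "iterated_centralizer G S {\<one>} m \<subseteq> iterated_centralizer G S {\<one>} n"
  using assms by (intro iterated_centralizer_increasing) (auto simp: commutator_one_left)

text \<open>
  The inductive step rests on \<open>[x y, s] = [x, s]\<^sup>y [y, s]\<close> and \<open>[x\<^sup>g, s] = [x, s']\<^sup>g\<close>, where \<open>s'\<close> is a
  conjugate of \<open>s\<close>; normality of \<open>S\<close> keeps \<open>s'\<close> in \<open>S\<close>.
\<close>

lemma iterated_centralizer_normal:
  assumes K: "K \<lhd> G" and S: "S \<lhd> G"
  shows "iterated_centralizer G S K n \<lhd> G"
proof (induction n)
  case 0
  then show ?case using K by simp
next
  case (Suc n)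
  let ?Z = "iterated_centralizer G S K n"
  interpret Z: normal ?Z G by fact
  interpret S: normal S G by fact
  have S_closed: "s \<in> carrier G" if "s \<in> S" for s using that S.subset by auto
  show ?case
  proof (rule normalI_conjugate)
    show "subgroup (iterated_centralizer G S K (Suc n)) G"
    proof (rule subgroupI)
      show "iterated_centralizer G S K (Suc n) \<noteq> {}"
        using S_closed by (auto simp: commutator_one_left intro!: exI[of _ \<one>])
    qed (auto simp: S_closed commutator_mult_left commutator_inv_left Z.inv_op_closed1 Z.inv_op_closed2)
  next
    fix g x assume g: "g \<in> carrier G" and x: "x \<in> iterated_centralizer G S K (Suc n)"
    have "commutator G (conjugate G g x) s \<in> ?Z" if s: "s \<in> S" for s
    proof -
      have "conjugate G g (commutator G x (g \<otimes> s \<otimes> inv g)) = commutator G (conjugate G g x) s"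
        using g x s S_closed by (simp add: conjugate_commutator) (simp add: group_word_simps)
      moreover have "g \<otimes> s \<otimes> inv g \<in> S" using g s by (simp add: S.inv_op_closed2)
      ultimately show ?thesis
        using normal_conjugate_closed[OF Suc g] x by fastforce
    qed
    then show "conjugate G g x \<in> iterated_centralizer G S K (Suc n)"
      using g x by simp
  qed
qed

lemma normal_carrier: "carrier G \<lhd> G"
  by (rule normalI_conjugate) (auto intro: subgroup_self)

end

context group_hom
begin

lemma hom_commutator:
  assumes "x \<in> carrier G" "y \<in> carrier G"
  shows "h (commutator G x y) = commutator H (h x) (h y)"
  using assms by (simp add: commutator_def)

text \<open>
  Homomorphisms carry commutators to commutators; this is what allows every argument below to be made
  modulo a normal subgroup by making it in the quotient.
\<close>

lemma iterated_centralizer_hom_iff: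
  assumes "x \<in> carrier G" "S \<subseteq> carrier G"
  shows "h x \<in> iterated_centralizer H (h ` S) K n
     \<longleftrightarrow> x \<in> iterated_centralizer G S {y \<in> carrier G. h y \<in> K} n"
  using assms
proof (induction n arbitrary: x)
  case (Suc n)
  have "commutator H (h x) (h s) \<in> iterated_centralizer H (h ` S) K n
     \<longleftrightarrow> commutator G x s \<in> iterated_centralizer G S {y \<in> carrier G. h y \<in> K} n"
    if "s \<in> S" for s
    using Suc.IH[of "commutator G x s"] Suc.prems that by (auto simp: hom_commutator subset_iff)
  then show ?case using Suc.prems by auto
qed auto

end

context normal
begin

lemma coset_group_hom: "group_hom G (G Mod H) ((#>) H)"
  by (simp add: group_hom_def group_hom_axioms_def factorgroup_is_group r_coset_hom_Mod is_group)

lemma coset_eq_self_iff: "x \<in> carrier G \<Longrightarrow> H #> x = H \<longleftrightarrow> x \<in> H"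
  using rcos_self subgroup_axioms coset_join2 by blast

lemma coset_eq_iff:
  assumes "x \<in> carrier G" "y \<in> carrier G"
  shows "H #> x = H #> y \<longleftrightarrow> inv y \<otimes> x \<in> H"
proof -
  interpret q: group_hom G "G Mod H" "(#>) H" by (rule coset_group_hom)
  have "H #> x = H #> y \<longleftrightarrow> H #> (inv y \<otimes> x) = \<one>\<^bsub>G Mod H\<^esub>"
    using assms by (metis q.H.inv_closed q.H.inv_equality q.H.inv_inv q.H.l_inv q.hom_closed q.hom_inv q.hom_mult
        inv_closed)
  then show ?thesis using assms coset_eq_self_iff[of "inv y \<otimes> x"] by simp
qed

lemma cosets_commute_iff:
  assumes "x \<in> carrier G" "y \<in> carrier G"
  shows "(H #> x) \<otimes>\<^bsub>G Mod H\<^esub> (H #> y) = (H #> y) \<otimes>\<^bsub>G Mod H\<^esub> (H #> x) \<longleftrightarrow> commutator G x y \<in> H"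
proof -
  interpret q: group_hom G "G Mod H" "(#>) H" by (rule coset_group_hom)
  show ?thesis
    using assms q.H.commutator_eq_one_iff[of "H #> x" "H #> y"] q.hom_commutator[of x y]
      coset_eq_self_iff[of "commutator G x y"]
    by (metis commutator_closed one_FactGroup q.hom_closed)
qed

lemma iterated_centralizer_coset_iff:
  assumes "x \<in> carrier G" "S \<subseteq> carrier G"
  shows "H #> x \<in> iterated_centralizer (G Mod H) ((#>) H ` S) {\<one>\<^bsub>G Mod H\<^esub>} n
     \<longleftrightarrow> x \<in> iterated_centralizer G S H n"
proof -
  have "{y \<in> carrier G. H #> y \<in> {\<one>\<^bsub>G Mod H\<^esub>}} = H"
    using coset_eq_self_iff subset by auto
  then show ?thesis
    using group_hom.iterated_centralizer_hom_iff[OF coset_group_hom assms, of "{\<one>\<^bsub>G Mod H\<^esub>}" n]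
    by (simp only:)
qed

end

context group
begin

text \<open>
  Centrality of the coset of \<open>x\<close> modulo \<open>Z\<^sub>n\<close> means \<open>[x, s] \<in> Z\<^sub>n\<close> for all \<open>s\<close>.
\<close>

lemma upper_central_eq: "upper_central G n = iterated_centralizer G (carrier G) {\<one>} n"
proof (induction n)
  case (Suc n)
  let ?Z = "iterated_centralizer G (carrier G) {\<one>} n"
  interpret Z: normal ?Z G
    by (rule iterated_centralizer_normal[OF one_is_normal normal_carrier])
  have "?Z #> x \<in> group_center (G Mod ?Z) \<longleftrightarrow> (\<forall>s\<in>carrier G. commutator G x s \<in> ?Z)"
    if "x \<in> carrier G" for x
    using that Z.cosets_commute_iff[OF that] unfolding group_center_def carrier_FactGroup by auto
  then show ?case by (auto simp: Suc)
qed simp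

lemma upper_central_normal: "upper_central G n \<lhd> G"
  unfolding upper_central_eq by (rule iterated_centralizer_normal[OF one_is_normal normal_carrier])

lemma upper_central_increasing: "m \<le> n \<Longrightarrow> upper_central G m \<subseteq> upper_central G n"
  unfolding upper_central_eq by (rule iterated_centralizer_one_increasing) auto

lemma nilpotent_group_iff:
  "nilpotent_group G \<longleftrightarrow> (\<exists>n. carrier G \<subseteq> iterated_centralizer G (carrier G) {\<one>} n)"
  using iterated_centralizer_subset[of "{\<one>}" "carrier G"]
  unfolding nilpotent_group_def upper_central_eq by (auto simp: is_group)

lemma nilpotent_quotient_iff:
  assumes "K \<lhd> G"
  shows "nilpotent_group (G Mod K) \<longleftrightarrow> (\<exists>n. carrier G \<subseteq> iterated_centralizer G (carrier G) K n)"
proof -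
  interpret K: normal K G by fact
  interpret q: group "G Mod K" by (rule K.factorgroup_is_group)
  show ?thesis
    unfolding q.nilpotent_group_iff carrier_FactGroup image_subset_iff
    using K.iterated_centralizer_coset_iff[of _ "carrier G"] by (simp add: subset_iff Ball_def)
qed

lemma nilpotent_subgroup_iff:
  assumes "subgroup H G"
  shows "nilpotent_group (G\<lparr>carrier := H\<rparr>) \<longleftrightarrow> (\<exists>n. H \<subseteq> iterated_centralizer G H {\<one>} n)"
proof -
  interpret H: group "G\<lparr>carrier := H\<rparr>" using assms by (rule subgroup_imp_group)
  have sub: "H \<subseteq> carrier G" using assms by (rule subgroup.subset)
  interpret i: group_hom "G\<lparr>carrier := H\<rparr>" G "\<lambda>x. x"
    by unfold_locales (use sub in \<open>auto simp: hom_def\<close>)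
  have one: "{y \<in> H. y = \<one>} = {\<one>}" using assms subgroup.one_closed by auto
  have "x \<in> iterated_centralizer G H {\<one>} n
    \<longleftrightarrow> x \<in> iterated_centralizer (G\<lparr>carrier := H\<rparr>) H {\<one>} n" if "x \<in> H" for x n
    using i.iterated_centralizer_hom_iff[of x H "{\<one>}" n] that by (simp add: one)
  then show ?thesis unfolding H.nilpotent_group_iff by (auto simp: subset_iff)
qed

end

section \<open>Subgroups generated by a finite normal set\<close>

definition word_product :: "('a, 'b) monoid_scheme \<Rightarrow> 'a list \<Rightarrow> 'a" where
  "word_product G w = foldr (\<otimes>\<^bsub>G\<^esub>) w \<one>\<^bsub>G\<^esub>"

definition products_of_length :: "('a, 'b) monoid_scheme \<Rightarrow> 'a set \<Rightarrow> nat \<Rightarrow> 'a set" where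
  "products_of_length G X n = {word_product G w | w. set w \<subseteq> X \<and> length w = n}"

context group
begin

lemma word_product_simps [simp]:
  "word_product G [] = \<one>" "word_product G (x # w) = x \<otimes> word_product G w"
  by (simp_all add: word_product_def)

lemma word_product_closed [simp, intro]:
  "set w \<subseteq> carrier G \<Longrightarrow> word_product G w \<in> carrier G"
  by (induction w) auto

lemma word_product_append:
  "set v \<subseteq> carrier G \<Longrightarrow> set w \<subseteq> carrier G \<Longrightarrow>
     word_product G (v @ w) = word_product G v \<otimes> word_product G w"
  by (induction v) (auto simp: m_assoc)

lemma products_of_length_mult:
  assumes "X \<subseteq> carrier G" "x \<in> products_of_length G X m" "y \<in> products_of_length G X n"
  shows "x \<otimes> y \<in> products_of_length G X (m + n)"
proof -
  obtain v w where "x = word_product G v" "set v \<subseteq> X" "length v = m"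
    "y = word_product G w" "set w \<subseteq> X" "length w = n"
    using assms unfolding products_of_length_def by blast
  then show ?thesis
    using assms(1) word_product_append[of v w]
    unfolding products_of_length_def by (intro CollectI exI[of _ "v @ w"]) auto
qed

lemma products_of_length_1: "X \<subseteq> carrier G \<Longrightarrow> x \<in> X \<Longrightarrow> x \<in> products_of_length G X (Suc 0)"
  unfolding products_of_length_def by (intro CollectI exI[of _ "[x]"]) auto

lemma pow_in_products_of_length:
  assumes "X \<subseteq> carrier G" "x \<in> X"
  shows "x [^] (n :: nat) \<in> products_of_length G X n"
proof (induction n)
  case 0
  then show ?case by (auto simp: products_of_length_def)
next
  case (Suc n)
  show ?case
    using products_of_length_mult[OF assms(1) Suc products_of_length_1[OF assms]] by simp
qed

text \<open>
  A letter \<open>x\<close> can be moved to the front of a word at the price of conjugating the letters it passes by \<open>x\<close>.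
\<close>

lemma collect_letter:
  assumes X: "X \<subseteq> carrier G" and conj: "\<And>x y. x \<in> X \<Longrightarrow> y \<in> X \<Longrightarrow> conjugate G x y \<in> X"
    and x: "x \<in> X" and w: "set w \<subseteq> X" "c \<le> count_list w x"
  shows "\<exists>v. set v \<subseteq> X \<and> length v + c = length w \<and> word_product G w = x [^] c \<otimes> word_product G v"
  using w
proof (induction w arbitrary: c)
  case Nil
  then show ?case by simp
next
  case (Cons y w)
  have y: "y \<in> X" and w: "set w \<subseteq> X" using Cons.prems by auto
  have G: "x \<in> carrier G" "y \<in> carrier G" using x y X by auto
  show ?case
  proof (cases "y = x \<and> c > 0")
    case True
    then obtain d where c: "c = Suc d" by (cases c) auto
    then obtain v where v: "set v \<subseteq> X" "length v + d = length w"
      "word_product G w = x [^] d \<otimes> word_product G v"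
      using Cons.IH[OF w, of d] Cons.prems True by auto
    have "word_product G (y # w) = x [^] c \<otimes> word_product G v"
      using v True G X nat_pow_Suc2[of x d] by (simp add: c m_assoc[symmetric] subset_trans del: nat_pow_Suc)
    then show ?thesis using v c by auto
  next
    case False
    then have "c \<le> count_list w x" using Cons.prems by (auto split: if_splits)
    then obtain v where v: "set v \<subseteq> X" "length v + c = length w"
      "word_product G w = x [^] c \<otimes> word_product G v"
      using Cons.IH[OF w] by blast
    have "conjugate G (x [^] k) z \<in> X" if "z \<in> X" for z and k :: nat
    proof (induction k)
      case (Suc k)
      have "conjugate G (x [^] Suc k) z = conjugate G x (conjugate G (x [^] k) z)"
        using G that X by (auto simp: group_word_simps subset_iff)
      then show ?case using conj[OF x Suc] by simp
    qed (use that X in auto)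
    then have y': "conjugate G (x [^] c) y \<in> X" using y by blast
    (* The letter y, which precedes the collected power of x, is passed by it. *)
    have "word_product G (y # w) = x [^] c \<otimes> word_product G (conjugate G (x [^] c) y # v)"
      using v G X subset_trans[OF v(1) X] by (simp add: group_word_simps)
    then show ?thesis using v y' by (intro exI[of _ "conjugate G (x [^] c) y # v"]) simp
  qed
qed

lemma exists_frequent_letter:
  assumes "finite X" "set w \<subseteq> X" "card X * N < length w"
  shows "\<exists>x\<in>X. N < count_list w x"
proof (rule ccontr)
  assume "\<not> ?thesis"
  then have "(\<Sum>x\<in>X. count_list w x) \<le> (\<Sum>x\<in>X. N)" by (intro sum_mono) auto
  moreover have "length w = (\<Sum>x\<in>X. count_list w x)"
    using assms sum_count_set by metis
  ultimately show False using assms by simp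
qed

text \<open>
  A variant of Dietzmann's lemma. A long word contains some letter \<open>x\<close> often; collecting these occurrences
  produces a high power of \<open>x\<close>, which by hypothesis equals a product with one factor less. So all elements are
  represented by words of bounded length.
\<close>

theorem finite_generate_of_shortening:
  assumes X: "X \<subseteq> carrier G" and fin: "finite X"
    and conj: "\<And>x y. x \<in> X \<Longrightarrow> y \<in> X \<Longrightarrow> conjugate G x y \<in> X"
    and inv: "\<And>x. x \<in> X \<Longrightarrow> inv x \<in> X"
    and short: "\<And>x. x \<in> X \<Longrightarrow> \<exists>n. x [^] Suc n \<in> products_of_length G X n"
  shows "finite (generate G X)"
proof -
  let ?P = "products_of_length G X"
  obtain n where n: "\<And>x. x \<in> X \<Longrightarrow> x [^] Suc (n x) \<in> ?P (n x)" using short by metis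
  (* One exponent N serves all letters: surplus factors x are simply kept. *)
  define N where "N = Max (insert 0 (n ` X))"
  have N: "x [^] Suc N \<in> ?P N" if x: "x \<in> X" for x
  proof -
    have le: "n x \<le> N" using that fin by (auto simp: N_def)
    have "x [^] (N - n x) \<otimes> x [^] Suc (n x) \<in> ?P (N - n x + n x)"
      by (rule products_of_length_mult[OF X pow_in_products_of_length[OF X x] n[OF x]])
    moreover have "x [^] (N - n x) \<otimes> x [^] Suc (n x) = x [^] Suc N"
      using x X le nat_pow_mult[of x "N - n x" "Suc (n x)"] by (auto simp del: nat_pow_Suc)
    ultimately show ?thesis using le by simp
  qed
  define L where "L = card X * N"
  have shorten: "?P (Suc k) \<subseteq> ?P k" if k: "L \<le> k" for k
  proof
    fix y assume "y \<in> ?P (Suc k)"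
    then obtain w where w: "y = word_product G w" "set w \<subseteq> X" "length w = Suc k"
      by (auto simp: products_of_length_def)
    obtain x where x: "x \<in> X" "Suc N \<le> count_list w x"
      using exists_frequent_letter[OF fin w(2), of N] w k by (auto simp: L_def)
    obtain v where v: "set v \<subseteq> X" "length v + Suc N = length w"
      "word_product G w = x [^] Suc N \<otimes> word_product G v"
      using collect_letter[OF X conj x(1) w(2) x(2)] by blast
    have "word_product G v \<in> ?P (length v)" using v by (auto simp: products_of_length_def)
    then have "y \<in> ?P (N + length v)"
      using products_of_length_mult[OF X N[OF x(1)]] v w by simp
    then show "y \<in> ?P k" using v w by (simp add: add.commute)
  qed
  have bounded: "?P k \<subseteq> (\<Union>i\<le>L. ?P i)" for k
  proof (cases "k \<le> L")
    case False
    have "?P (L + i) \<subseteq> ?P L" for i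
      by (induction i) (use shorten[of "L + _"] in auto)
    from this[of "k - L"] False show ?thesis by auto
  qed auto
  have "generate G X \<subseteq> (\<Union>k. ?P k)"
  proof
    fix y assume "y \<in> generate G X"
    then show "y \<in> (\<Union>k. ?P k)"
    proof induction
      case one
      have "\<one> \<in> ?P 0" by (auto simp: products_of_length_def)
      then show ?case by blast
    next
      case (incl h)
      then show ?case using products_of_length_1[OF X] by blast
    next
      case (inv h)
      then show ?case using products_of_length_1[OF X] assms(4) by blast
    next
      case (eng h1 h2)
      then show ?case using products_of_length_mult[OF X] by blast
    qed
  qed
  also have "\<dots> \<subseteq> (\<Union>i\<le>L. ?P i)" using bounded by blast
  finally show ?thesis
  proof (rule finite_subset)
    have "?P i = word_product G ` {w. set w \<subseteq> X \<and> length w = i}" for i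
      by (auto simp: products_of_length_def)
    then show "finite (\<Union>i\<le>L. ?P i)" using fin by (simp add: finite_lists_length_eq)
  qed
qed

end

section \<open>Finitely many commutators: the Schur--Baer step\<close>

definition commutators_with :: "('a, 'b) monoid_scheme \<Rightarrow> 'a set \<Rightarrow> 'a set" where
  "commutators_with G L = {commutator G l g | l g. l \<in> L \<and> g \<in> carrier G}"

context group
begin

lemma commutators_with_subset: "L \<subseteq> carrier G \<Longrightarrow> commutators_with G L \<subseteq> carrier G"
  by (auto simp: commutators_with_def)

lemma conjugate_nat_pow:
  assumes "g \<in> carrier G" "x \<in> carrier G"
  shows "conjugate G g (x [^] (n :: nat)) = conjugate G g x [^] n"
proof (induction n)
  case (Suc n)
  have "conjugate G g (x [^] Suc n) = conjugate G g (x [^] n) \<otimes> conjugate G g x"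
    using assms by (simp add: group_word_simps)
  then show ?case using Suc by simp
qed (use assms in simp)

lemma conjugate_commutators_with:
  assumes "L \<lhd> G" "x \<in> commutators_with G L" "g \<in> carrier G"
  shows "conjugate G g x \<in> commutators_with G L"
proof -
  interpret L: normal L G by fact
  obtain l h where x: "x = commutator G l h" "l \<in> L" "h \<in> carrier G"
    using assms by (auto simp: commutators_with_def)
  then have "conjugate G g x = commutator G (conjugate G g l) (conjugate G g h)"
    using assms L.subset by (simp add: conjugate_commutator subset_iff)
  moreover have "conjugate G g l \<in> L" using x assms by (simp add: normal_conjugate_closed)
  ultimately show ?thesis using x assms unfolding commutators_with_def by blast
qed

lemma generate_commutators_with_normal:
  assumes "L \<lhd> G"
  shows "generate G (commutators_with G L) \<lhd> G"
proof (rule normal_generateI)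
  show "commutators_with G L \<subseteq> carrier G"
    using assms by (simp add: commutators_with_subset normal_imp_subgroup subgroup.subset)
  fix x g assume "x \<in> commutators_with G L" "g \<in> carrier G"
  then show "g \<otimes> x \<otimes> inv g \<in> commutators_with G L"
    using conjugate_commutators_with[OF assms, of x "inv g"] by simp
qed

lemma inv_commutators_with:
  assumes "L \<lhd> G" "x \<in> commutators_with G L"
  shows "inv x \<in> commutators_with G L"
proof -
  interpret L: normal L G by fact
  obtain l g where x: "x = commutator G l g" "l \<in> L" "g \<in> carrier G"
    using assms by (auto simp: commutators_with_def)
  have "inv x = commutator G (conjugate G g l) (inv g)"
    using x L.subset by (auto simp: commutator_def group_word_simps)
  moreover have "conjugate G g l \<in> L" using x assms by (simp add: normal_conjugate_closed)
  ultimately show ?thesis using x unfolding commutators_with_def by blast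
qed

text \<open>
  Schur's identity: in \<open>x\<^sup>m\<^sup>+\<^sup>2 = l\<inverse> g\<inverse> l g x\<^sup>m\<^sup>+\<^sup>1\<close> the last \<open>g\<close> may be moved behind the power. The right-hand side
  has \<open>m + 1\<close> factors, one less than the left-hand side, and each of them is a commutator of a conjugate of \<open>l\<close>.
\<close>

lemma commutator_pow_Suc_Suc:
  assumes G: "l \<in> carrier G" "g \<in> carrier G"
    and comm: "commutator G l g [^] Suc m \<otimes> g = g \<otimes> commutator G l g [^] Suc m"
  shows "commutator G l g [^] Suc (Suc m) =
           commutator G l (g \<otimes> g) \<otimes> commutator G (conjugate G g l) g [^] m"
proof -
  let ?x = "commutator G l g"
  have "?x [^] Suc (Suc m) = ?x \<otimes> ?x [^] Suc m"
    using G by (intro nat_pow_Suc2 commutator_closed)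
  also have "\<dots> = inv l \<otimes> inv g \<otimes> l \<otimes> (g \<otimes> ?x [^] Suc m)"
    using G by (simp add: commutator_def m_assoc del: nat_pow_Suc)
  also have "\<dots> = inv l \<otimes> inv g \<otimes> l \<otimes> ((?x \<otimes> ?x [^] m) \<otimes> g)"
    using G nat_pow_Suc2[of ?x m] comm by (simp del: nat_pow_Suc)
  also have "\<dots> = inv l \<otimes> inv g \<otimes> l \<otimes> ?x \<otimes> g \<otimes> conjugate G g (?x [^] m)"
    using G by (simp add: group_word_simps)
  also have "inv l \<otimes> inv g \<otimes> l \<otimes> ?x \<otimes> g = commutator G l (g \<otimes> g)"
    using G by (simp add: commutator_def group_word_simps)
  also have "conjugate G g (?x [^] m) = commutator G (conjugate G g l) g [^] m"
  proof -
    have "conjugate G g ?x = commutator G (conjugate G g l) g"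
      using G by (simp add: commutator_def group_word_simps)
    then show ?thesis using G by (simp only: conjugate_nat_pow commutator_closed)
  qed
  finally show ?thesis .
qed

lemma group_center_iff_commutator:
  "z \<in> group_center G \<longleftrightarrow> z \<in> carrier G \<and> (\<forall>x\<in>carrier G. commutator G z x = \<one>)"
  by (auto simp: group_center_def commutator_eq_one_iff)

lemma group_center_subgroup: "subgroup (group_center G) G"
proof (rule subgroupI)
  show "group_center G \<noteq> {}"
    by (auto simp: group_center_def intro: exI[of _ \<one>])
qed (auto simp: group_center_iff_commutator commutator_inv_left commutator_mult_left)

text \<open>
  Two powers of \<open>x\<close> lie in the same coset of the centre, by the pigeonhole principle.
\<close>

lemma central_power:
  assumes "finite F" "F \<subseteq> carrier G" "x \<in> carrier G"
    and "\<And>n :: nat. \<exists>z \<in> group_center G. \<exists>f \<in> F. x [^] n = z \<otimes> f"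
  shows "\<exists>m. x [^] Suc m \<in> group_center G"
proof -
  obtain z f where zf: "\<And>n :: nat. z n \<in> group_center G" "\<And>n. f n \<in> F" "\<And>n. x [^] n = z n \<otimes> f n"
    using assms(4) by metis
  have "\<not> inj f"
    using assms(1) zf(2) by (meson finite_imageD finite_subset image_subsetI infinite_UNIV_nat)
  then obtain i j where "f i = f j" "i < j"
    by (metis injI linorder_neqE_nat)
  have zG: "z k \<in> carrier G" "f k \<in> carrier G" for k
    using zf(1,2)[of k] assms(2) by (auto simp: group_center_def)
  have "x [^] i \<otimes> x [^] (j - i) = x [^] j"
    using assms \<open>i < j\<close> by (simp add: nat_pow_mult)
  moreover have "x [^] (j - i) \<otimes> x [^] i = x [^] j"
    using assms \<open>i < j\<close> by (simp add: nat_pow_mult)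
  ultimately have "x [^] (j - i) \<otimes> (z i \<otimes> f i) = z j \<otimes> f i"
    using zf \<open>f i = f j\<close> by metis
  then have "(x [^] (j - i) \<otimes> z i) \<otimes> f i = z j \<otimes> f i"
    using zG assms by (simp add: m_assoc)
  then have comm: "x [^] (j - i) \<otimes> z i = z j"
    using zG assms by (metis m_closed nat_pow_closed right_cancel)
  have eq: "x [^] (j - i) = inv (z i) \<otimes> z j"
  proof -
    have "z i \<otimes> x [^] (j - i) = x [^] (j - i) \<otimes> z i"
      using zf(1)[of i] assms(3) by (simp add: group_center_def)
    then have "z j = z i \<otimes> x [^] (j - i)" using comm by simp
    then show ?thesis using zG assms(3) by (simp add: mult_inv_cancel)
  qed
  interpret center: subgroup "group_center G" G by (rule group_center_subgroup)
  have "x [^] (j - i) \<in> group_center G"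
    unfolding eq using zf(1) by blast
  then show ?thesis
    using \<open>i < j\<close> by (metis Suc_diff_Suc)
qed

text \<open>
  The Schur--Baer step. The commutators \<open>[l, g]\<close> depend only on the classes of \<open>l\<close> modulo the centre and of \<open>g\<close>
  modulo \<open>C\<close>, so there are finitely many of them. Each lies in \<open>L\<close> and hence has a central power, so Schur's identity
  supplies the shortening hypothesis.
\<close>

lemma finite_generate_commutators_with:
  assumes L: "L \<lhd> G"
    and F: "finite F" "F \<subseteq> carrier G" "\<And>l. l \<in> L \<Longrightarrow> \<exists>z \<in> group_center G. \<exists>f \<in> F. l = z \<otimes> f"
    and F': "finite F'" "F' \<subseteq> carrier G" "\<And>g. g \<in> carrier G \<Longrightarrow> \<exists>c \<in> C. \<exists>f \<in> F'. g = c \<otimes> f"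
    and C: "C \<subseteq> carrier G" "\<And>c l. c \<in> C \<Longrightarrow> l \<in> L \<Longrightarrow> c \<otimes> l = l \<otimes> c"
  shows "finite (generate G (commutators_with G L))"
proof -
  interpret L: normal L G by fact
  let ?X = "commutators_with G L"
  have XG: "?X \<subseteq> carrier G" using L.subset by (rule commutators_with_subset)
  have "?X \<subseteq> (\<lambda>(f, f'). commutator G f f') ` (F \<times> F')"
  proof
    fix x assume "x \<in> ?X"
    then obtain l g where x: "x = commutator G l g" and l: "l \<in> L" and g: "g \<in> carrier G"
      by (auto simp: commutators_with_def)
    obtain z f where zf: "z \<in> group_center G" "f \<in> F" "l = z \<otimes> f" using F(3)[OF l] by blast
    obtain c f' where cf: "c \<in> C" "f' \<in> F'" "g = c \<otimes> f'" using F'(3)[OF g] by blast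
    have G: "z \<in> carrier G" "f \<in> carrier G" "c \<in> carrier G" "f' \<in> carrier G"
      using zf cf F F' C by (auto simp: group_center_def)
    have z: "z \<otimes> y = y \<otimes> z" if "y \<in> carrier G" for y
      using zf(1) that by (auto simp: group_center_def)
    have "c \<otimes> (z \<otimes> f) = (z \<otimes> f) \<otimes> c" using C(2)[OF cf(1) l] zf(3) by simp
    then have "z \<otimes> (c \<otimes> f) = z \<otimes> (f \<otimes> c)"
      using G z[of c] by (metis m_assoc)
    then have cf_comm: "c \<otimes> f = f \<otimes> c" using G by simp
    have "g \<otimes> l = (g \<otimes> z) \<otimes> f" using zf(3) G g by (simp add: m_assoc)
    also have "\<dots> = z \<otimes> (g \<otimes> f)" using G g z[of g] by (simp add: m_assoc[symmetric])
    finally have "g \<otimes> l = z \<otimes> (g \<otimes> f)" .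
    moreover have "l \<otimes> g = z \<otimes> (f \<otimes> g)"
      using zf(3) G g by (simp add: m_assoc)
    moreover have "x = inv (g \<otimes> l) \<otimes> (l \<otimes> g)"
      using g l L.subset unfolding x by (auto simp: commutator_def group_word_simps)
    ultimately have "x = inv (g \<otimes> f) \<otimes> (f \<otimes> g)"
      using G g by (simp add: group_word_simps)
    also have "f \<otimes> g = c \<otimes> (f \<otimes> f')" using cf(3) G cf_comm by (metis m_assoc)
    also have "inv (g \<otimes> f) \<otimes> (c \<otimes> (f \<otimes> f')) = commutator G f f'"
      using cf(3) G by (simp add: commutator_def group_word_simps)
    finally show "x \<in> (\<lambda>(f, f'). commutator G f f') ` (F \<times> F')" using zf cf by blast
  qed
  then have fin: "finite ?X" using F(1) F'(1) by (meson finite_SigmaI finite_imageI finite_subset)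
  show ?thesis
  proof (rule finite_generate_of_shortening[OF XG fin])
    fix x y assume "x \<in> ?X" "y \<in> ?X"
    then show "conjugate G x y \<in> ?X" using conjugate_commutators_with[OF L] XG by auto
  next
    fix x assume x: "x \<in> ?X"
    then show "inv x \<in> ?X" by (rule inv_commutators_with[OF L])
    obtain l g where lg: "x = commutator G l g" "l \<in> L" "g \<in> carrier G"
      using x by (auto simp: commutators_with_def)
    have lG: "l \<in> carrier G" using lg L.subset by auto
    have "x \<in> L" using commutator_in_normal_left[OF L] lg by simp
    then have pow: "x [^] n \<in> L" for n :: nat
      by (induction n) auto
    have "\<exists>m. x [^] Suc m \<in> group_center G"
      using XG x by (intro central_power[OF F(1,2) _ F(3)[OF pow]]) auto
    then obtain m where "x [^] Suc m \<in> group_center G" ..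
    then have "x [^] Suc m \<otimes> g = g \<otimes> x [^] Suc m"
      using lg unfolding group_center_def by blast
    then have "x [^] Suc (Suc m) =
        commutator G l (g \<otimes> g) \<otimes> commutator G (conjugate G g l) g [^] m"
      using lg lG by (simp only: commutator_pow_Suc_Suc)
    moreover have "commutator G l (g \<otimes> g) \<in> ?X" "commutator G (conjugate G g l) g \<in> ?X"
      using lg normal_conjugate_closed[OF L lg(3,2)] unfolding commutators_with_def by blast+
    ultimately have "x [^] Suc (Suc m) \<in> products_of_length G ?X (Suc 0 + m)"
      using products_of_length_mult[OF XG products_of_length_1[OF XG] pow_in_products_of_length[OF XG]]
      by metis
    then show "\<exists>n. x [^] Suc n \<in> products_of_length G ?X n" by (intro exI[of _ "Suc m"]) simp
  qed
qed

end

section \<open>Baer's theorem\<close>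

context group
begin

text \<open>
  The case of the three subgroups lemma that is needed below: moving \<open>z\<close> past \<open>u g\<close> and past \<open>g u\<close> produces
  the same error term \<open>d c\<close>, so \<open>z\<close> commutes with the quotient \<open>(u g) (g u)\<inverse>\<close>.
\<close>

lemma commutes_with_commutator:
  assumes G: "z \<in> carrier G" "u \<in> carrier G" "g \<in> carrier G"
    and c: "c = commutator G z u" and d: "d = commutator G z g"
    and comm: "c \<otimes> g = g \<otimes> c" "d \<otimes> u = u \<otimes> d" "c \<otimes> d = d \<otimes> c"
  shows "z \<otimes> commutator G (inv u) (inv g) = commutator G (inv u) (inv g) \<otimes> z"
proof -
  define p q where "p = u \<otimes> g" and "q = g \<otimes> u"
  have cd: "c \<in> carrier G" "d \<in> carrier G" and pq: "p \<in> carrier G" "q \<in> carrier G"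
    using G by (auto simp: c d p_def q_def)
  have zu: "z \<otimes> u = u \<otimes> z \<otimes> c" and zg: "z \<otimes> g = g \<otimes> z \<otimes> d"
    using G by (simp_all add: c d commutator_def group_word_simps)
  have "z \<otimes> p = (z \<otimes> u) \<otimes> g" using G by (simp add: p_def m_assoc)
  also have "\<dots> = u \<otimes> z \<otimes> (c \<otimes> g)" using G cd by (simp add: zu m_assoc)
  also have "\<dots> = u \<otimes> (z \<otimes> g) \<otimes> c" using G cd by (simp add: comm m_assoc)
  also have "\<dots> = p \<otimes> (z \<otimes> d \<otimes> c)" using G cd by (simp add: zg p_def m_assoc)
  finally have zp: "z \<otimes> p = p \<otimes> (z \<otimes> d \<otimes> c)" .
  have "z \<otimes> q = (z \<otimes> g) \<otimes> u" using G by (simp add: q_def m_assoc)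
  also have "\<dots> = g \<otimes> z \<otimes> (d \<otimes> u)" using G cd by (simp add: zg m_assoc)
  also have "\<dots> = g \<otimes> (z \<otimes> u) \<otimes> d" using G cd by (simp add: comm m_assoc)
  also have "\<dots> = q \<otimes> (z \<otimes> d \<otimes> c)" using G cd by (simp add: zu q_def m_assoc comm)
  finally have zq: "z \<otimes> q = q \<otimes> (z \<otimes> d \<otimes> c)" .
  have y: "z \<otimes> d \<otimes> c = inv q \<otimes> (z \<otimes> q)"
    using G cd pq by (simp add: zq mult_inv_cancel)
  have "z \<otimes> (p \<otimes> inv q) = p \<otimes> (inv q \<otimes> (z \<otimes> q)) \<otimes> inv q"
    using G cd pq zp by (simp add: m_assoc[symmetric] flip: y)
  also have "\<dots> = (p \<otimes> inv q) \<otimes> z"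
    using G pq by (simp add: group_word_simps)
  finally show ?thesis
    using G by (simp add: p_def q_def commutator_def group_word_simps)
qed

lemma commutator_mem_of_three_commutators:
  assumes K: "K \<lhd> G" and G: "z \<in> carrier G" "u \<in> carrier G" "g \<in> carrier G"
    and "commutator G (commutator G z u) g \<in> K" "commutator G (commutator G z g) u \<in> K"
      "commutator G (commutator G z u) (commutator G z g) \<in> K"
  shows "commutator G z (commutator G (inv u) (inv g)) \<in> K"
proof -
  interpret K: normal K G by fact
  interpret q: group_hom G "G Mod K" "(#>) K" by (rule K.coset_group_hom)
  have "(K #> z) \<otimes>\<^bsub>G Mod K\<^esub> commutator (G Mod K) (inv\<^bsub>G Mod K\<^esub> (K #> u)) (inv\<^bsub>G Mod K\<^esub> (K #> g))
      = commutator (G Mod K) (inv\<^bsub>G Mod K\<^esub> (K #> u)) (inv\<^bsub>G Mod K\<^esub> (K #> g)) \<otimes>\<^bsub>G Mod K\<^esub> (K #> z)"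
    by (rule q.H.commutes_with_commutator[OF _ _ _ refl refl])
       (use assms in \<open>simp_all add: K.cosets_commute_iff del: mult_FactGroup flip: q.hom_commutator\<close>)
  then show ?thesis
    using G by (simp add: K.cosets_commute_iff q.hom_commutator del: mult_FactGroup
        flip: q.hom_inv q.hom_commutator)
qed

lemma upper_central_Suc_iff:
  "x \<in> upper_central G (Suc n) \<longleftrightarrow> x \<in> carrier G \<and> (\<forall>g\<in>carrier G. commutator G x g \<in> upper_central G n)"
  unfolding upper_central_eq by simp

lemma commutator_upper_central:
  assumes "x \<in> upper_central G n" "g \<in> carrier G"
  shows "commutator G x g \<in> upper_central G (n - 1)"
proof (cases n)
  case 0
  then show ?thesis using assms by (simp add: commutator_one_left)
next
  case (Suc m)
  then show ?thesis using assms by (simp add: upper_central_Suc_iff del: upper_central.simps)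
qed

text \<open>
  The property \<open>[\<gamma>\<^sub>i\<^sub>+\<^sub>1, Z\<^sub>j] \<subseteq> Z\<^sub>j\<^sub>-\<^sub>i\<^sub>-\<^sub>1\<close> of the lower central series, demanded of an
  arbitrary set \<open>L\<close> in place of \<open>\<gamma>\<^sub>i\<^sub>+\<^sub>1\<close>. Truncated subtraction is intended: for \<open>j \<le> i + 1\<close> the commutator is trivial.
\<close>

definition acts_as_lower_central :: "nat \<Rightarrow> 'a set \<Rightarrow> bool" where
  "acts_as_lower_central i L \<longleftrightarrow>
     (\<forall>j. \<forall>z \<in> upper_central G j. \<forall>u \<in> L. commutator G z u \<in> upper_central G (j - Suc i))"

text \<open>
  For a generator \<open>[l, g]\<close> the three commutators in \<open>commutator_mem_of_three_commutators\<close> lie in \<open>Z\<^sub>j\<^sub>-\<^sub>i\<^sub>-\<^sub>2\<close>: \<open>[z, l\<inverse>]\<close> is in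
  \<open>Z\<^sub>j\<^sub>-\<^sub>i\<^sub>-\<^sub>1\<close>, and \<open>[z, g\<inverse>]\<close> is in \<open>Z\<^sub>j\<^sub>-\<^sub>1\<close>, where the hypothesis applies again. The elements with the
  required property are closed under products and inverses.
\<close>

lemma acts_as_lower_central_step:
  assumes L: "L \<lhd> G" and act: "acts_as_lower_central i L"
  shows "acts_as_lower_central (Suc i) (generate G (commutators_with G L))"
  unfolding acts_as_lower_central_def
proof (intro allI ballI)
  fix j z u
  assume z: "z \<in> upper_central G j" and u: "u \<in> generate G (commutators_with G L)"
  let ?K = "upper_central G (j - Suc (Suc i))"
  interpret L: normal L G by fact
  interpret K: normal ?K G by (rule upper_central_normal)
  interpret Zj: normal "upper_central G j" G by (rule upper_central_normal)
  have zG: "z \<in> carrier G" using z Zj.subset by auto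
  have basic: "commutator G z v \<in> ?K" if v: "v \<in> commutators_with G L" for v
  proof -
    obtain l g where v: "v = commutator G l g" "l \<in> L" "g \<in> carrier G"
      using v by (auto simp: commutators_with_def)
    have lG: "l \<in> carrier G" using v L.subset by auto
    have c: "commutator G z (inv l) \<in> upper_central G (j - Suc i)"
      using act z v unfolding acts_as_lower_central_def by simp
    have d: "commutator G z (inv g) \<in> upper_central G (j - 1)"
      using commutator_upper_central[OF z] v by simp
    have "commutator G (commutator G z (inv g)) (inv l) \<in> upper_central G (j - 1 - Suc i)"
      using act d v unfolding acts_as_lower_central_def by (metis L.m_inv_closed)
    moreover have "commutator G (commutator G z (inv l)) y \<in> ?K" if "y \<in> carrier G" for y
      using commutator_upper_central[OF c that] by simp
    ultimately have "commutator G z (commutator G (inv (inv l)) (inv (inv g))) \<in> ?K"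
      using zG lG v by (intro commutator_mem_of_three_commutators K.normal_axioms) simp_all
    then show ?thesis using v lG by simp
  qed
  have XG: "commutators_with G L \<subseteq> carrier G" using L.subset by (rule commutators_with_subset)
  show "commutator G z u \<in> ?K"
    using u
  proof induction
    case one
    then show ?case using zG by (simp add: commutator_def)
  next
    case (incl h)
    then show ?case by (rule basic)
  next
    case (inv h)
    then have "h \<in> carrier G" using XG by auto
    then show ?case
      using basic[OF inv] zG by (simp add: commutator_inv_right K.inv_op_closed2)
  next
    case (eng h1 h2)
    then have "h1 \<in> carrier G" "h2 \<in> carrier G" using generate_in_carrier[OF XG] by auto
    then show ?case
      using eng zG by (simp add: commutator_mult_right K.inv_op_closed1)
  qed
qed

text \<open>
  The Schur--Baer step modulo a normal subgroup \<open>K\<close>, obtained in \<open>G / K\<close>.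
\<close>

lemma finite_cosets_generate_commutators_with:
  assumes K: "K \<lhd> G" and Z: "Z \<lhd> G" and C: "C \<lhd> G" and L: "L \<lhd> G"
    and central: "\<And>z g. z \<in> Z \<Longrightarrow> g \<in> carrier G \<Longrightarrow> commutator G z g \<in> K"
    and commute: "\<And>c l. c \<in> C \<Longrightarrow> l \<in> L \<Longrightarrow> commutator G c l \<in> K"
    and finL: "finite ((#>) Z ` L)" and finC: "finite ((#>) C ` carrier G)"
  shows "finite ((#>) K ` generate G (commutators_with G L))"
proof -
  interpret K: normal K G by fact
  interpret Z: normal Z G by fact
  interpret C: normal C G by fact
  interpret L: normal L G by fact
  interpret q: group_hom G "G Mod K" "(#>) K" by (rule K.coset_group_hom)
  have reps: "\<exists>F. finite F \<and> F \<subseteq> S \<and> (\<forall>s\<in>S. \<exists>x\<in>N. \<exists>f\<in>F. s = x \<otimes> f)"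
    if N: "N \<lhd> G" and S: "S \<subseteq> carrier G" and fin: "finite ((#>) N ` S)" for N S
  proof -
    interpret N: normal N G by fact
    obtain F where F: "finite F" "F \<subseteq> S" "(#>) N ` S = (#>) N ` F"
      using fin by (metis finite_subset_image subset_refl)
    have "\<exists>x\<in>N. \<exists>f\<in>F. s = x \<otimes> f" if s: "s \<in> S" for s
    proof -
      obtain f where f: "f \<in> F" "N #> s = N #> f" using F s by blast
      have "s \<in> N #> f" using f s S rcos_self[OF _ N.subgroup_axioms, of s] by auto
      then show ?thesis using f by (auto simp: r_coset_def)
    qed
    then show ?thesis using F by blast
  qed
  obtain F where F: "finite F" "F \<subseteq> L" "\<forall>s\<in>L. \<exists>x\<in>Z. \<exists>f\<in>F. s = x \<otimes> f"
    using reps[OF Z L.subset finL] by blast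
  obtain F' where F': "finite F'" "F' \<subseteq> carrier G" "\<forall>s\<in>carrier G. \<exists>x\<in>C. \<exists>f\<in>F'. s = x \<otimes> f"
    using reps[OF C subset_refl finC] by blast
  have img: "commutators_with (G Mod K) ((#>) K ` L) = (#>) K ` commutators_with G L"
    unfolding commutators_with_def carrier_FactGroup
    using L.subset by (force simp: subset_iff q.hom_commutator)
  have comm_coset: "(K #> x) \<otimes>\<^bsub>G Mod K\<^esub> (K #> y) = (K #> y) \<otimes>\<^bsub>G Mod K\<^esub> (K #> x)"
    if "commutator G x y \<in> K" "x \<in> carrier G" "y \<in> carrier G" for x y
    using K.cosets_commute_iff that by blast
  have "finite (generate (G Mod K) (commutators_with (G Mod K) ((#>) K ` L)))"
  proof (rule q.H.finite_generate_commutators_with)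
    show "(#>) K ` L \<lhd> G Mod K"
      by (rule L.surj_hom_normal_subgroup[OF q.group_hom_axioms]) (simp add: carrier_FactGroup)
    show "finite ((#>) K ` F)" "finite ((#>) K ` F')" using F F' by auto
    show "(#>) K ` F \<subseteq> carrier (G Mod K)" "(#>) K ` F' \<subseteq> carrier (G Mod K)"
        "(#>) K ` C \<subseteq> carrier (G Mod K)"
      using F(2) F'(2) L.subset C.subset by auto
  next
    fix l' assume "l' \<in> (#>) K ` L"
    then obtain l where l: "l \<in> L" "l' = K #> l" by blast
    then obtain z f where zf: "z \<in> Z" "f \<in> F" "l = z \<otimes> f" using F(3) by blast
    have G: "z \<in> carrier G" "f \<in> carrier G" using zf F(2) L.subset Z.subset by auto
    have "K #> z \<in> group_center (G Mod K)"
      using G zf comm_coset central unfolding group_center_def carrier_FactGroup by blast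
    then show "\<exists>z\<in>group_center (G Mod K). \<exists>f\<in>(#>) K ` F. l' = z \<otimes>\<^bsub>G Mod K\<^esub> f"
      using l zf G q.hom_mult by blast
  next
    fix g' assume "g' \<in> carrier (G Mod K)"
    then obtain g where g: "g \<in> carrier G" "g' = K #> g" by (auto simp: carrier_FactGroup)
    then obtain c f where cf: "c \<in> C" "f \<in> F'" "g = c \<otimes> f" using F'(3) by blast
    have "c \<in> carrier G" "f \<in> carrier G" using cf F'(2) C.subset by auto
    then show "\<exists>c\<in>(#>) K ` C. \<exists>f\<in>(#>) K ` F'. g' = c \<otimes>\<^bsub>G Mod K\<^esub> f"
      using g cf q.hom_mult by blast
  next
    fix c' l' assume "c' \<in> (#>) K ` C" "l' \<in> (#>) K ` L"
    then show "c' \<otimes>\<^bsub>G Mod K\<^esub> l' = l' \<otimes>\<^bsub>G Mod K\<^esub> c'"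
      using comm_coset commute L.subset C.subset by blast
  qed
  then show ?thesis
    unfolding img q.generate_img[OF commutators_with_subset[OF L.subset]] .
qed

text \<open>
  Baer's theorem. The normal subgroup \<open>L\<close> constructed for \<open>i\<close> is \<open>\<gamma>\<^sub>i\<^sub>+\<^sub>1(G)\<close>; for \<open>i = m\<close> it is finite modulo
  \<open>Z\<^sub>0(G) = 1\<close>, and \<open>G / L\<close> is nilpotent.
\<close>

theorem finite_by_nilpotent_of_finite_index_upper_central:
  assumes fin: "finite (carrier (G Mod upper_central G m))"
  shows "\<exists>K. finite K \<and> K \<lhd> G \<and> nilpotent_group (G Mod K)"
proof -
  let ?Z = "upper_central G" and ?IC = "iterated_centralizer G (carrier G)"
  have finZ: "finite ((#>) (?Z m) ` carrier G)"
    using fin by (simp add: carrier_FactGroup)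
  have "\<exists>L. L \<lhd> G \<and> carrier G \<subseteq> ?IC L i \<and> acts_as_lower_central i L
          \<and> finite ((#>) (?Z (m - i)) ` L)" if "i \<le> m" for i
    using that
  proof (induction i)
    case 0
    have "acts_as_lower_central 0 (carrier G)"
      unfolding acts_as_lower_central_def using commutator_upper_central by simp
    then show ?case
      using finZ normal_carrier by (intro exI[of _ "carrier G"]) auto
  next
    case (Suc i)
    then obtain L where L: "L \<lhd> G" "carrier G \<subseteq> ?IC L i" "acts_as_lower_central i L"
      "finite ((#>) (?Z (m - i)) ` L)" by auto
    interpret L: normal L G by fact
    let ?L' = "generate G (commutators_with G L)"
    have "L \<subseteq> ?IC ?L' 1"
      using L.subset by (auto simp: commutators_with_def intro!: generate.incl)
    then have "?IC L i \<subseteq> ?IC (?IC ?L' 1) i"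
      by (rule iterated_centralizer_mono[OF subset_refl])
    also have "\<dots> = ?IC ?L' (Suc i)"
      by (simp add: iterated_centralizer_add del: iterated_centralizer.simps)
    finally have IC: "carrier G \<subseteq> ?IC ?L' (Suc i)" using L(2) by blast
    have "finite ((#>) (?Z (m - Suc i)) ` ?L')"
    proof (rule finite_cosets_generate_commutators_with[OF upper_central_normal _ _ L(1)])
      show "?Z (m - i) \<lhd> G" "?Z m \<lhd> G" by (rule upper_central_normal)+
      show "commutator G z g \<in> ?Z (m - Suc i)" if "z \<in> ?Z (m - i)" "g \<in> carrier G" for z g
        using commutator_upper_central[OF that] by simp
      show "commutator G c l \<in> ?Z (m - Suc i)" if "c \<in> ?Z m" "l \<in> L" for c l
        using L(3) that unfolding acts_as_lower_central_def by blast
    qed (fact L(4) finZ)+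
    then show ?case
      using IC generate_commutators_with_normal[OF L(1)] acts_as_lower_central_step[OF L(1,3)]
      by blast
  qed
  from this[of m] obtain K where K: "K \<lhd> G" "carrier G \<subseteq> ?IC K m" "finite ((#>) {\<one>} ` K)"
    by auto
  interpret K: normal K G by fact
  have "(#>) {\<one>} ` K = (\<lambda>x. {x}) ` K"
    using K.subset by (auto simp: r_coset_def)
  then have "finite K" using K(3) by (simp add: finite_image_iff)
  then show ?thesis using K nilpotent_quotient_iff by blast
qed

end

section \<open>Unipotent automorphisms of abelian groups\<close>

context group
begin

lemma commutator_pow_right:
  assumes G: "v \<in> carrier G" "h \<in> carrier G"
    and comm: "commutator G v h \<otimes> h = h \<otimes> commutator G v h"
  shows "commutator G v (h [^] (i :: nat)) = commutator G v h [^] i"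
proof (induction i)
  case 0
  then show ?case using G by (simp add: commutator_def)
next
  case (Suc i)
  let ?d = "commutator G v h"
  have "conjugate G h ?d = ?d"
    using G comm by (simp add: m_assoc mult_inv_cancel)
  then have "conjugate G h (?d [^] i) = ?d [^] i"
    using G conjugate_nat_pow[of h ?d i] by simp
  then show ?case
    using G Suc nat_pow_Suc2[of ?d i] by (simp add: commutator_mult_right)
qed

lemma normal_pow_closed:
  assumes "B \<lhd> G" "x \<in> B"
  shows "x [^] (n :: nat) \<in> B"
proof -
  interpret B: normal B G by fact
  show ?thesis using assms(2) by (induction n) auto
qed

lemma commutator_pow_left:
  assumes B: "B \<lhd> G" and ab: "\<And>x y. x \<in> B \<Longrightarrow> y \<in> B \<Longrightarrow> x \<otimes> y = y \<otimes> x"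
    and x: "x \<in> B" and g: "g \<in> carrier G"
  shows "commutator G (x [^] (i :: nat)) g = commutator G x g [^] i"
proof (induction i)
  case 0
  then show ?case using g by (simp add: commutator_one_left)
next
  case (Suc i)
  interpret B: normal B G by fact
  have xG: "x \<in> carrier G" using x B.subset by auto
  have pow: "x [^] i \<in> B" using normal_pow_closed[OF B x] .
  have "commutator G (x [^] i) g \<in> B" using commutator_in_normal_left[OF B pow g] .
  then have "conjugate G x (commutator G (x [^] i) g) = commutator G (x [^] i) g"
    using ab[OF _ x] xG g by (simp add: m_assoc mult_inv_cancel)
  then show ?case
    using Suc xG g by (simp add: commutator_mult_left)
qed

lemma iterated_centralizer_singleton_Suc:
  assumes "x \<in> iterated_centralizer G {g} K (Suc n)"
  shows "x \<in> carrier G" "commutator G x g \<in> iterated_centralizer G {g} K n"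
  using assms by auto

text \<open>
  In additive notation, let \<open>T = g - 1\<close> act on \<open>B\<close>. If \<open>n\<^sup>j\<close> kills \<open>T b'\<close> for all \<open>b'\<close> in the kernel of \<open>T\<^sup>j\<^sup>+\<^sup>1\<close>,
  then for \<open>b\<close> in the kernel of \<open>T\<^sup>j\<^sup>+\<^sup>2\<close> and \<open>c = n\<^sup>j b\<close> the element \<open>d = T c\<close> is fixed by \<open>g\<close>. Hence \<open>g\<^sup>n c = c + n d\<close>, and
  \<open>g\<^sup>n c = c\<close> gives \<open>n d = 0\<close>.
\<close>

lemma commutator_torsion:
  assumes B: "B \<lhd> G" and ab: "\<And>x y. x \<in> B \<Longrightarrow> y \<in> B \<Longrightarrow> x \<otimes> y = y \<otimes> x"
    and g: "g \<in> carrier G" and n: "\<And>x. x \<in> B \<Longrightarrow> x \<otimes> g [^] n = g [^] n \<otimes> x"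
    and b: "b \<in> B" "b \<in> iterated_centralizer G {g} {\<one>} (Suc j)"
  shows "commutator G b g [^] (n ^ j :: nat) = \<one>"
  using b
proof (induction j arbitrary: b)
  case 0
  then show ?case by simp
next
  case (Suc j)
  interpret B: normal B G by fact
  let ?b1 = "commutator G b g" and ?c = "b [^] (n ^ j)"
  have b1: "?b1 \<in> B" using commutator_in_normal_left[OF B Suc.prems(1) g] .
  have G: "b \<in> carrier G" "?b1 \<in> carrier G" using Suc.prems b1 B.subset by auto
  have c: "?c \<in> B" using normal_pow_closed[OF B Suc.prems(1)] .
  have d: "commutator G ?c g = ?b1 [^] (n ^ j)"
    by (rule commutator_pow_left[OF B ab Suc.prems(1) g])
  have "commutator G (?b1 [^] (n ^ j)) g = commutator G ?b1 g [^] (n ^ j)"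
    by (rule commutator_pow_left[OF B ab b1 g])
  also have "\<dots> = \<one>"
    using Suc.IH[OF b1] iterated_centralizer_singleton_Suc(2)[OF Suc.prems(2)] by simp
  finally have "?b1 [^] (n ^ j) \<otimes> g = g \<otimes> ?b1 [^] (n ^ j)"
    using G g by (simp add: commutator_eq_one_iff)
  then have "commutator G ?c (g [^] n) = commutator G ?c g [^] n"
    using G g d by (intro commutator_pow_right) auto
  moreover have "commutator G ?c (g [^] n) = \<one>"
    using n[OF c] G g by (simp add: commutator_eq_one_iff)
  ultimately show ?case
    using d G by (simp add: nat_pow_pow mult.commute)
qed

text \<open>
  Over a field of characteristic \<open>p\<close> this is \<open>(g - 1)\<^bsup>p^j\<^esup> = g\<^bsup>p^j\<^esup> - 1\<close>. For the induction, put
  \<open>h = g\<^bsup>p^j\<^esup>\<close>: as \<open>h\<close> fixes \<open>[v, g]\<close>, the element \<open>d = [v, h]\<close> is fixed by \<open>g\<close>, so \<open>h\<^sup>p\<close> moves \<open>v\<close> by \<open>d\<^sup>p = 1\<close>.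
\<close>

lemma prime_power_centralizes:
  assumes E: "E \<lhd> G" and ab: "\<And>x y. x \<in> E \<Longrightarrow> y \<in> E \<Longrightarrow> x \<otimes> y = y \<otimes> x"
    and p: "\<And>x. x \<in> E \<Longrightarrow> x [^] (p :: nat) = \<one>"
    and g: "g \<in> carrier G"
    and v: "v \<in> E" "v \<in> iterated_centralizer G {g} {\<one>} j"
  shows "v \<otimes> g [^] (p ^ j) = g [^] (p ^ j) \<otimes> v"
  using v
proof (induction j arbitrary: v)
  case 0
  then show ?case using g by simp
next
  case (Suc j)
  interpret E: normal E G by fact
  define h where "h = g [^] (p ^ j)"
  define v1 where "v1 = commutator G v g"
  define d where "d = commutator G v h"
  have hG: "h \<in> carrier G" and hg: "g \<otimes> h = h \<otimes> g"
    using g nat_pow_Suc2[of g "p ^ j"] by (simp_all add: h_def)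
  have v1: "v1 \<in> E" unfolding v1_def by (rule commutator_in_normal_left[OF E Suc.prems(1) g])
  have d: "d \<in> E" unfolding d_def by (rule commutator_in_normal_left[OF E Suc.prems(1) hG])
  have G: "v \<in> carrier G" "v1 \<in> carrier G" "d \<in> carrier G"
    using v1 d Suc.prems E.subset by auto
  have v1h: "v1 \<otimes> h = h \<otimes> v1"
    using Suc.IH[OF v1] iterated_centralizer_singleton_Suc(2)[OF Suc.prems(2)] by (simp add: h_def v1_def)
  have vg: "v \<otimes> g = g \<otimes> (v \<otimes> v1)" and vh: "v \<otimes> h = h \<otimes> (v \<otimes> d)"
    using G g hG by (simp_all add: v1_def d_def commutator_def group_word_simps)
  have "v \<otimes> g \<otimes> h = g \<otimes> v \<otimes> (v1 \<otimes> h)" using G g hG by (simp add: vg m_assoc)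
  also have "\<dots> = g \<otimes> (v \<otimes> h) \<otimes> v1" using G g hG by (simp add: v1h m_assoc)
  also have "\<dots> = (g \<otimes> h) \<otimes> (v \<otimes> d \<otimes> v1)" using G g hG by (simp add: vh m_assoc)
  finally have 1: "v \<otimes> g \<otimes> h = (h \<otimes> g) \<otimes> (v \<otimes> d \<otimes> v1)" by (simp add: hg)
  have "v \<otimes> h \<otimes> g = h \<otimes> v \<otimes> (d \<otimes> g)" using G g hG by (simp add: vh m_assoc)
  moreover have "v \<otimes> h \<otimes> g = v \<otimes> g \<otimes> h" using G g hG by (simp add: hg m_assoc)
  ultimately have "h \<otimes> (v \<otimes> (d \<otimes> g)) = h \<otimes> (g \<otimes> (v \<otimes> d \<otimes> v1))"
    using 1 G g hG by (simp add: m_assoc)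
  then have "v \<otimes> (d \<otimes> g) = g \<otimes> (v \<otimes> d \<otimes> v1)"
    using G g hG by simp
  also have "\<dots> = (g \<otimes> (v \<otimes> v1)) \<otimes> d" using ab[OF d v1] G g by (simp add: m_assoc)
  also have "\<dots> = v \<otimes> (g \<otimes> d)" using G g by (simp add: m_assoc flip: vg)
  finally have "d \<otimes> g = g \<otimes> d" using G g by simp
  then have "d \<otimes> h = h \<otimes> d"
    unfolding h_def using G g by (metis group_commutes_pow)
  then have "commutator G v (h [^] p) = d [^] p"
    unfolding d_def using G hG by (intro commutator_pow_right) auto
  then have "v \<otimes> h [^] p = h [^] p \<otimes> v"
    using p[OF d] G hG by (simp add: commutator_eq_one_iff)
  then show ?case using g by (simp add: h_def nat_pow_pow mult.commute)
qed

lemma finite_generate_of_bounded_exponent: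
  assumes "finite S" "S \<subseteq> carrier G" "e > 0" "\<And>x. x \<in> S \<Longrightarrow> x [^] (e :: nat) = \<one>"
    and "\<And>x y. x \<in> generate G S \<Longrightarrow> y \<in> generate G S \<Longrightarrow> x \<otimes> y = y \<otimes> x"
  shows "finite (generate G S) \<and> card (generate G S) \<le> e ^ card S"
  using assms
proof (induction S)
  case empty
  then show ?case by (simp add: generate_empty)
next
  case (insert s S)
  let ?H = "generate G S" and ?H' = "generate G (insert s S)"
  have SG: "S \<subseteq> carrier G" and sG: "s \<in> carrier G" using insert.prems by auto
  have HG: "?H \<subseteq> carrier G" using generate_in_carrier[OF SG] by blast
  have sub: "?H \<subseteq> ?H'" by (rule mono_generate) auto
  have IH: "finite ?H" "card ?H \<le> e ^ card S"
    using insert.IH insert.prems sub by (auto simp: subset_iff)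
  have s: "s \<in> ?H'" by (rule generate.incl) simp
  have comm: "x \<otimes> s = s \<otimes> x" if "x \<in> ?H" for x
    using insert.prems(4) that s sub by blast
  have se: "s [^] e = \<one>" using insert.prems by simp
  have mod: "s [^] (i mod e) = s [^] i" for i
  proof -
    have "s [^] i = s [^] (e * (i div e)) \<otimes> s [^] (i mod e)"
      using sG by (simp add: nat_pow_mult)
    also have "s [^] (e * (i div e)) = \<one>"
      using sG se by (simp flip: nat_pow_pow)
    finally show ?thesis using sG by simp
  qed
  have "?H' \<subseteq> (\<lambda>(i, x). s [^] i \<otimes> x) ` ({..<e} \<times> ?H)" (is "_ \<subseteq> ?T")
  proof
    have T: "s [^] i \<otimes> x \<in> ?T" if "x \<in> ?H" for i :: nat and x
      using that mod[of i] \<open>e > 0\<close> by (intro image_eqI[of _ _ "(i mod e, x)"]) auto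
    have T0: "x \<in> ?T" if "x \<in> ?H" for x
      using T[OF that, of 0] subsetD[OF HG that] by simp
    fix y assume "y \<in> ?H'"
    then show "y \<in> ?T"
    proof induction
      case one
      show ?case by (rule T0[OF generate.one])
    next
      case (incl h)
      show ?case
      proof (cases "h = s")
        case True
        then show ?thesis using T[OF generate.one, of 1] sG by simp
      next
        case False
        then show ?thesis using incl by (intro T0 generate.incl) simp
      qed
    next
      case (inv h)
      show ?case
      proof (cases "h = s")
        case True
        obtain e' where "e = Suc e'" using \<open>e > 0\<close> gr0_implies_Suc by blast
        then have "inv s = s [^] e'"
          using se sG by (intro inv_equality) auto
        then show ?thesis using T[OF generate.one, of e'] sG True by simp
      next
        case False
        then have "h \<in> S" using inv by simp
        then show ?thesis by (intro T0 generate.inv)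
      qed
    next
      case (eng h1 h2)
      have T_E: "\<exists>(i :: nat) x. z = s [^] i \<otimes> x \<and> x \<in> ?H" if "z \<in> ?T" for z
        using that by auto
      obtain i j :: nat and x y where h: "h1 = s [^] i \<otimes> x" "x \<in> ?H" "h2 = s [^] j \<otimes> y" "y \<in> ?H"
        using T_E[OF eng.IH(1)] T_E[OF eng.IH(2)] by blast
      have G: "x \<in> carrier G" "y \<in> carrier G" using h HG by auto
      have "x \<otimes> s [^] j = s [^] j \<otimes> x"
        using comm[OF h(2)] G sG by (metis group_commutes_pow)
      then have "h1 \<otimes> h2 = s [^] i \<otimes> (s [^] j \<otimes> x) \<otimes> y"
        using h(1,3) G sG by (metis m_assoc nat_pow_closed m_closed)
      then have "h1 \<otimes> h2 = s [^] (i + j) \<otimes> (x \<otimes> y)"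
        using G sG by (simp add: m_assoc flip: nat_pow_mult)
      then show ?case using T[of "x \<otimes> y" "i + j"] generate.eng[OF h(2,4)] by simp
    qed
  qed
  moreover have fin: "finite ?T" using IH by simp
  ultimately have "finite ?H'" "card ?H' \<le> card ?T"
    using finite_subset card_mono by blast+
  moreover have "card ?T \<le> e * card ?H"
    using card_image_le[of "{..<e} \<times> ?H"] IH by (simp add: card_cartesian_product)
  moreover have "e * card ?H \<le> e ^ card (insert s S)"
    using IH insert.hyps by simp
  ultimately show ?case by linarith
qed


end

section \<open>Fixed points of p-groups\<close>

context group
begin

text \<open>Cauchy's theorem, in the form of the subgroup given by Sylow's theorem.\<close>

lemma exists_element_of_prime_order:
  assumes "finite (carrier G)" "Factorial_Ring.prime q" "q dvd Coset.order G"
  shows "\<exists>P. subgroup P G \<and> card P = q \<and> (\<forall>x\<in>P. x [^] q = \<one>)"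
proof -
  obtain m where "Coset.order G = q ^ 1 * m" using assms(3) by auto
  then obtain P where P: "subgroup P G" "card P = q ^ 1"
    using sylow_thm[OF assms(2) is_group _ assms(1)] by blast
  interpret P: group "G\<lparr>carrier := P\<rparr>" using P(1) by (rule subgroup_imp_group)
  have "x [^] q = \<one>" if "x \<in> P" for x
    using P.pow_order_eq_1[of x] that P(2) by (simp add: Coset.order_def flip: nat_pow_consistent)
  then show ?thesis using P by auto
qed

text \<open>
  By Cauchy's theorem another prime divisor of the order would be the order of some element.
\<close>

lemma prime_dvd_order_of_prime_power_torsion:
  assumes fin: "finite (carrier G)" and p: "Factorial_Ring.prime p"
    and tors: "\<And>x. x \<in> carrier G \<Longrightarrow> \<exists>j. x [^] (p ^ j :: nat) = \<one>"
    and q: "Factorial_Ring.prime q" "q dvd Coset.order G"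
  shows "q = p"
proof (rule ccontr)
  assume "q \<noteq> p"
  obtain P where P: "subgroup P G" "card P = q" "\<forall>x\<in>P. x [^] q = \<one>"
    using exists_element_of_prime_order[OF fin q] by blast
  have "x = \<one>" if x: "x \<in> P" for x
  proof -
    have xG: "x \<in> carrier G" using P(1) x by (rule subgroup.mem_carrier)
    obtain j where "x [^] (p ^ j) = \<one>" using tors[OF xG] by blast
    moreover have "x [^] q = \<one>" using P(3) x by blast
    ultimately have "ord x dvd p ^ j" "ord x dvd q"
      using xG by (simp_all add: pow_eq_id)
    moreover have "coprime (p ^ j) q"
      using p q \<open>q \<noteq> p\<close> by (simp add: primes_coprime)
    ultimately have "ord x = 1" by (meson coprime_common_divisor_nat)
    then show ?thesis using xG ord_eq_1 by blast
  qed
  then have "P \<subseteq> {\<one>}" by blast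
  then have "card P \<le> 1" using card_mono[of "{\<one>}" P] by simp
  then show False using P(2) prime_gt_1_nat[OF q(1)] by simp
qed

end

text \<open>
  The class equation: every orbit other than a fixed point has size divisible by \<open>p\<close>, hence so has the set of
  fixed points.
\<close>

lemma (in group_action) exists_second_fixed_point:
  assumes finG: "finite (carrier G)" and finE: "finite E"
    and p: "Factorial_Ring.prime p" "p dvd card E"
    and order: "\<And>q. Factorial_Ring.prime q \<Longrightarrow> q dvd Coset.order G \<Longrightarrow> q = p"
    and e: "e \<in> E" "\<And>g. g \<in> carrier G \<Longrightarrow> \<phi> g e = e"
  shows "\<exists>v\<in>E. v \<noteq> e \<and> (\<forall>g\<in>carrier G. \<phi> g v = v)"
proof (rule ccontr)
  assume none: "\<not> ?thesis"
  interpret G: group G using group_hom group_hom.axioms(1) by auto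
  have orb_e: "orbit G \<phi> e = {e}" using e(2) by (auto simp: orbit_def intro!: exI[of _ \<one>])
  have dvd: "p dvd card X" if X: "X \<in> orbits G E \<phi> - {{e}}" for X
  proof -
    obtain v where v: "v \<in> E" "X = orbit G \<phi> v" using X by (auto simp: orbits_def)
    then have "v \<noteq> e" using X orb_e by auto
    then obtain g where g: "g \<in> carrier G" "\<phi> g v \<noteq> v" using none v by blast
    have "{v, \<phi> g v} \<subseteq> X" using orbit_refl[OF v(1)] g v(2) by (auto simp: orbit_def)
    moreover have "finite X" using v finG by (simp add: orbit_def)
    ultimately have "card X \<noteq> 1" using g(2) by (metis card_1_singletonE insert_subset singletonD)
    then obtain q where q: "Factorial_Ring.prime q" "q dvd card X"
      using prime_factor_nat by blast
    then have "q dvd Coset.order G"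
      using orbit_stabilizer_theorem[OF v(1)] v(2) by (metis dvd_mult2)
    then show ?thesis using order q by blast
  qed
  have "{e} \<in> orbits G E \<phi>" using e(1) orb_e by (auto simp: orbits_def)
  moreover have fin: "finite (orbits G E \<phi>)" using finE by (auto simp: orbits_def)
  moreover have "card E = (\<Sum>X\<in>orbits G E \<phi>. card X)"
    using disjoint_sum[OF finE, of "\<lambda>_. 1 :: nat"] by simp
  ultimately have "card E = card {e} + (\<Sum>X\<in>orbits G E \<phi> - {{e}}. card X)"
    by (simp add: sum.remove)
  moreover have "p dvd (\<Sum>X\<in>orbits G E \<phi> - {{e}}. card X)" using dvd by (rule dvd_sum)
  ultimately have "p dvd card {e}" using p(2) by (metis dvd_add_left_iff)
  then show False using p(1) by simp
qed

context group
begin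

lemma conjugate_eq_self_iff:
  assumes "h \<in> carrier G" "v \<in> carrier G"
  shows "h \<otimes> v \<otimes> inv h = v \<longleftrightarrow> v \<otimes> h = h \<otimes> v"
proof -
  have "v = h \<otimes> v \<otimes> inv h \<longleftrightarrow> h \<otimes> v = v \<otimes> h"
    using assms by (intro inv_solve_right m_closed)
  then show ?thesis by metis
qed

lemma conjugation_action_on_normal:
  assumes "E \<lhd> G"
  shows "group_action G E (\<lambda>g. \<lambda>v\<in>E. g \<otimes> v \<otimes> inv g)"
proof -
  interpret E: normal E G by fact
  let ?\<phi> = "\<lambda>g. \<lambda>v\<in>E. g \<otimes> v \<otimes> inv g"
  have EG: "v \<in> carrier G" if "v \<in> E" for v using that E.subset by auto
  have Bij: "?\<phi> g \<in> Bij E" if g: "g \<in> carrier G" for g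
  proof -
    have "bij_betw (\<lambda>v. g \<otimes> v \<otimes> inv g) E E"
      by (rule bij_betw_byWitness[where f' = "conjugate G g"])
         (use g EG in \<open>auto simp: group_word_simps\<close>,
          use g E.inv_op_closed1 E.inv_op_closed2 EG in \<open>auto simp: m_assoc\<close>)
    then show ?thesis by (simp add: Bij_def cong: bij_betw_cong)
  qed
  have "?\<phi> \<in> hom G (BijGroup E)"
  proof (rule homI)
    show "?\<phi> g \<in> carrier (BijGroup E)" if "g \<in> carrier G" for g
      using Bij[OF that] by (simp add: BijGroup_def)
    show "?\<phi> (g \<otimes> h) = ?\<phi> g \<otimes>\<^bsub>BijGroup E\<^esub> ?\<phi> h" if "g \<in> carrier G" "h \<in> carrier G" for g h
    proof -
      have "?\<phi> g \<otimes>\<^bsub>BijGroup E\<^esub> ?\<phi> h = compose E (?\<phi> g) (?\<phi> h)"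
        using Bij that by (simp add: BijGroup_def)
      also have "\<dots> = ?\<phi> (g \<otimes> h)"
        using that EG E.inv_op_closed2 by (auto simp: compose_def group_word_simps fun_eq_iff)
      finally show ?thesis by simp
    qed
  qed
  then show ?thesis
    by (simp add: group_action_def group_hom_def group_hom_axioms_def group_BijGroup is_group)
qed

text \<open>
  For a prime \<open>p\<close> dividing the order of \<open>V\<close>, the elements of \<open>V\<close> killed by \<open>p\<close> form a normal subgroup \<open>E\<close> on which every
  element of \<open>G\<close> acts with \<open>p\<close>-power order. The image \<open>Q\<close> of \<open>G\<close> in the permutations of \<open>E\<close> is therefore a finite
  \<open>p\<close>-group, and as \<open>p\<close> divides the order of \<open>E\<close>, the fixed point \<open>1\<close> is not the only one.
\<close>

lemma unipotent_finite_abelian_meets_center: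
  assumes V: "V \<lhd> G" and fin: "finite V" and nontriv: "V \<noteq> {\<one>}"
    and ab: "\<And>x y. x \<in> V \<Longrightarrow> y \<in> V \<Longrightarrow> x \<otimes> y = y \<otimes> x"
    and unip: "\<And>g. g \<in> carrier G \<Longrightarrow> V \<subseteq> iterated_centralizer G {g} {\<one>} k"
  shows "\<exists>v\<in>V. v \<noteq> \<one> \<and> v \<in> group_center G"
proof -
  interpret V: normal V G by fact
  interpret GV: group "G\<lparr>carrier := V\<rparr>" using V.subgroup_axioms by (rule subgroup_imp_group)
  have VG: "x \<in> carrier G" if "x \<in> V" for x using that V.subset by auto
  have "card V \<noteq> 1" using nontriv V.one_closed by (metis card_1_singletonE singletonD)
  then obtain p where p: "Factorial_Ring.prime p" "p dvd card V" using prime_factor_nat by blast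
  obtain P where P: "subgroup P (G\<lparr>carrier := V\<rparr>)" "card P = p" "\<forall>x\<in>P. x [^]\<^bsub>G\<lparr>carrier := V\<rparr>\<^esub> p = \<one>"
    using GV.exists_element_of_prime_order[OF _ p(1)] fin p(2) by (auto simp: Coset.order_def)
  define E where "E = {v \<in> V. v [^] p = \<one>}"
  have E_sub: "subgroup E G"
  proof (rule subgroupI)
    show "E \<subseteq> carrier G" "E \<noteq> {}"
      using VG V.one_closed nat_pow_one[of p] unfolding E_def by blast+
    show "inv a \<in> E" if "a \<in> E" for a
      using that VG by (auto simp: E_def nat_pow_inv)
    show "a \<otimes> b \<in> E" if "a \<in> E" "b \<in> E" for a b
      using that VG ab by (auto simp: E_def pow_mult_distrib)
  qed
  then have E: "E \<lhd> G"
  proof (rule normalI_conjugate)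
    fix g x assume g: "g \<in> carrier G" and x: "x \<in> E"
    have "conjugate G g (x [^] p) = conjugate G g x [^] p"
      using g x VG by (intro conjugate_nat_pow) (auto simp: E_def)
    then show "conjugate G g x \<in> E"
      using g x normal_conjugate_closed[OF V g] by (simp add: E_def)
  qed
  interpret E: normal E G by fact
  have EV: "E \<subseteq> V" by (auto simp: E_def)
  have finE: "finite E" using EV fin by (rule finite_subset)
  have "p dvd card E"
  proof -
    have "P \<subseteq> E"
      using P subgroup.subset[OF P(1)] by (auto simp: E_def simp flip: nat_pow_consistent)
    moreover have "subgroup P G" using P(1) V.subgroup_axioms by (rule incl_subgroup[rotated])
    ultimately have "subgroup P (G\<lparr>carrier := E\<rparr>)"
      using E_sub subgroup_incl by blast
    then show ?thesis
      using group.lagrange[OF subgroup_imp_group[OF E_sub], of P] P(2)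
      by (simp add: Coset.order_def) (metis dvd_triv_right)
  qed
  let ?\<phi> = "\<lambda>g. \<lambda>v\<in>E. g \<otimes> v \<otimes> inv g"
  interpret act: group_action G E ?\<phi> using E by (rule conjugation_action_on_normal)
  interpret \<phi>: group_hom G "BijGroup E" ?\<phi> by (rule act.group_hom)
  (* G may be infinite; its image Q among the permutations of E is finite. *)
  define Q where "Q = (BijGroup E)\<lparr>carrier := ?\<phi> ` carrier G\<rparr>"
  have Q: "group Q" unfolding Q_def by (rule \<phi>.H.subgroup_imp_group[OF \<phi>.img_is_subgroup])
  interpret Q: group Q by fact
  interpret Q: group_action Q E "\<lambda>f. f"
  proof (intro group_action.intro group_hom.intro group_hom_axioms.intro Q group_BijGroup)
    show "(\<lambda>f. f) \<in> hom Q (BijGroup E)"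
      by (rule homI) (auto simp: Q_def simp del: restrict_apply)
  qed
  have finQ: "finite (carrier Q)"
  proof -
    have "carrier Q \<subseteq> Bij E"
      using subgroup.subset[OF \<phi>.img_is_subgroup] unfolding Q_def by (simp add: BijGroup_def)
    also have "\<dots> \<subseteq> E \<rightarrow>\<^sub>E E"
      unfolding PiE_def using Bij_imp_funcset Bij_imp_extensional by blast
    finally have "carrier Q \<subseteq> E \<rightarrow>\<^sub>E E" .
    then show ?thesis using finE by (meson finite_PiE finite_subset)
  qed
  have tors: "f [^]\<^bsub>Q\<^esub> (p ^ k) = \<one>\<^bsub>Q\<^esub>" if "f \<in> carrier Q" for f
  proof -
    obtain g where g: "g \<in> carrier G" "f = ?\<phi> g" using \<open>f \<in> carrier Q\<close> by (auto simp: Q_def)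
    have "v \<otimes> g [^] (p ^ k) = g [^] (p ^ k) \<otimes> v" if "v \<in> E" for v
      by (rule prime_power_centralizes[OF E _ _ g(1) that])
         (use that EV ab unip[OF g(1)] in \<open>auto simp: E_def\<close>)
    then have "?\<phi> (g [^] (p ^ k)) = (\<lambda>v\<in>E. v)"
      using g(1) E.subset by (intro restrict_ext) (simp add: conjugate_eq_self_iff subset_iff)
    moreover have "?\<phi> (g [^] (p ^ k)) = ?\<phi> g [^]\<^bsub>BijGroup E\<^esub> (p ^ k)"
      using g(1) by (rule \<phi>.hom_nat_pow)
    ultimately show ?thesis
      using g(2) by (simp add: Q_def BijGroup_def nat_pow_def)
  qed
  have "\<exists>v\<in>E. v \<noteq> \<one> \<and> (\<forall>f\<in>carrier Q. f v = v)"
  proof (rule Q.exists_second_fixed_point[OF finQ finE p(1) \<open>p dvd card E\<close>])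
    show "q = p" if "Factorial_Ring.prime q" "q dvd Coset.order Q" for q
      by (rule Q.prime_dvd_order_of_prime_power_torsion[OF finQ p(1) _ that]) (use tors in blast)
    show "f \<one> = \<one>" if "f \<in> carrier Q" for f using that by (auto simp: Q_def)
  qed simp
  then obtain v where v: "v \<in> E" "v \<noteq> \<one>" "\<And>g. g \<in> carrier G \<Longrightarrow> g \<otimes> v \<otimes> inv g = v"
    by (auto simp: Q_def)
  have "v \<otimes> g = g \<otimes> v" if "g \<in> carrier G" for g
    using v(3)[OF that] that v(1) E.subset by (simp add: conjugate_eq_self_iff subset_iff)
  then show ?thesis using v EV VG by (auto simp: group_center_def)
qed

end

section \<open>Unipotent actions are nilpotent\<close>

context group
begin

text \<open>
  As long as \<open>W\<close> is not contained in \<open>Z\<^sub>i(G)\<close>, its image modulo \<open>W \<inter> Z\<^sub>i(G)\<close> meets the centre of the quotient,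
  so \<open>W \<inter> Z\<^sub>i\<^sub>+\<^sub>1(G)\<close> is strictly larger. This can happen fewer than \<open>|W|\<close> times.
\<close>

lemma unipotent_finite_abelian_subset_upper_central:
  assumes W: "W \<lhd> G" and fin: "finite W"
    and ab: "\<And>x y. x \<in> W \<Longrightarrow> y \<in> W \<Longrightarrow> x \<otimes> y = y \<otimes> x"
    and unip: "\<And>g. g \<in> carrier G \<Longrightarrow> W \<subseteq> iterated_centralizer G {g} {\<one>} k"
  shows "W \<subseteq> upper_central G (card W)"
proof -
  let ?Z = "upper_central G"
  interpret W: normal W G by fact
  have "W \<subseteq> ?Z i \<or> i < card (W \<inter> ?Z i)" for i
  proof (induction i)
    case 0
    have "W \<inter> {\<one>} = {\<one>}" using W.one_closed by blast
    then show ?case by simp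
  next
    case (Suc i)
    show ?case
    proof (cases "W \<subseteq> ?Z i")
      case True
      then show ?thesis using upper_central_increasing[of i "Suc i"] by (meson le_SucI order_refl subset_trans)
    next
      case False
      define U where "U = W \<inter> ?Z i"
      have U: "U \<lhd> G" unfolding U_def using W upper_central_normal by (rule normal_subgroup_intersect)
      interpret U: normal U G by fact
      interpret q: group_hom G "G Mod U" "(#>) U" by (rule U.coset_group_hom)
      have "\<exists>v\<in>(#>) U ` W. v \<noteq> \<one>\<^bsub>G Mod U\<^esub> \<and> v \<in> group_center (G Mod U)"
      proof (rule q.H.unipotent_finite_abelian_meets_center)
        show "(#>) U ` W \<lhd> G Mod U"
          by (rule W.surj_hom_normal_subgroup[OF q.group_hom_axioms]) (simp add: carrier_FactGroup)
        show "finite ((#>) U ` W)" using fin by simp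
        obtain w where "w \<in> W" "w \<notin> ?Z i" using False by blast
        then have "U #> w \<noteq> U" using U.coset_eq_self_iff W.subset by (auto simp: U_def)
        then show "(#>) U ` W \<noteq> {\<one>\<^bsub>G Mod U\<^esub>}" using \<open>w \<in> W\<close> by auto
        show "x \<otimes>\<^bsub>G Mod U\<^esub> y = y \<otimes>\<^bsub>G Mod U\<^esub> x" if xy: "x \<in> (#>) U ` W" "y \<in> (#>) U ` W" for x y
        proof -
          obtain a b where "x = U #> a" "y = U #> b" "a \<in> W" "b \<in> W" using xy by blast
          then show ?thesis using ab W.subset by (metis q.hom_mult subsetD)
        qed
        show "(#>) U ` W \<subseteq> iterated_centralizer (G Mod U) {g'} {\<one>\<^bsub>G Mod U\<^esub>} k"
          if g': "g' \<in> carrier (G Mod U)" for g'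
        proof
          fix x assume "x \<in> (#>) U ` W"
          then obtain w where w: "x = U #> w" "w \<in> W" by blast
          obtain g where g: "g \<in> carrier G" "g' = U #> g" using g' by (auto simp: carrier_FactGroup)
          have "w \<in> iterated_centralizer G {g} U k"
            using unip[OF g(1)] iterated_centralizer_mono[of "{g}" "{g}" "{\<one>}" U k] w U.one_closed by auto
          then show "x \<in> iterated_centralizer (G Mod U) {g'} {\<one>\<^bsub>G Mod U\<^esub>} k"
            using U.iterated_centralizer_coset_iff[of w "{g}" k] w g W.subset by auto
        qed
      qed
      then obtain w where w: "w \<in> W" "U #> w \<noteq> U" "U #> w \<in> group_center (G Mod U)" by auto
      have wG: "w \<in> carrier G" using w W.subset by auto
      have "commutator G w g \<in> U" if "g \<in> carrier G" for g
        using w(3) that wG U.cosets_commute_iff[OF wG that] q.hom_closed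
        unfolding group_center_def by blast
      then have "w \<in> ?Z (Suc i)"
        unfolding upper_central_Suc_iff using wG by (auto simp: U_def)
      moreover have "w \<notin> ?Z i" using w U.coset_eq_self_iff[OF wG] by (auto simp: U_def)
      ultimately have "W \<inter> ?Z i \<subset> W \<inter> ?Z (Suc i)"
        using w upper_central_increasing[of i "Suc i"] by (auto simp del: upper_central.simps)
      then have "card (W \<inter> ?Z i) < card (W \<inter> ?Z (Suc i))"
        using fin by (intro psubset_card_mono) auto
      then show ?thesis using Suc False by linarith
    qed
  qed
  from this[of "card W"] show ?thesis
    using card_mono[OF fin, of "W \<inter> ?Z (card W)"] by auto
qed

text \<open>
  The generators are not permuted by conjugation; instead \<open>[b, g]\<^sup>h = [b, h]\<inverse> [b, g h]\<close>.
\<close>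

lemma generate_commutators_of_element_normal:
  assumes b: "b \<in> carrier G"
  shows "generate G {commutator G b g | g. g \<in> carrier G} \<lhd> G" (is "generate G ?S \<lhd> G")
proof (rule normalI_conjugate)
  have SG: "?S \<subseteq> carrier G" using b by auto
  show sub: "subgroup (generate G ?S) G" using SG by (rule generate_is_subgroup)
  fix h x assume h: "h \<in> carrier G" and x: "x \<in> generate G ?S"
  have S: "conjugate G h s \<in> generate G ?S" if s: "s \<in> ?S" for s
  proof -
    obtain g where g: "g \<in> carrier G" "s = commutator G b g" using s by blast
    have "conjugate G h s = inv (commutator G b h) \<otimes> commutator G b (g \<otimes> h)"
      using b g h by (simp add: commutator_mult_right mult_inv_cancel)
    moreover have "commutator G b h \<in> ?S" "commutator G b (g \<otimes> h) \<in> ?S" using g h by blast+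
    ultimately show ?thesis by (simp add: generate.eng generate.incl generate.inv)
  qed
  show "conjugate G h x \<in> generate G ?S"
    using x
  proof induction
    case one
    then show ?case using h by (simp add: generate.one)
  next
    case (incl s)
    then show ?case by (rule S)
  next
    case (inv s)
    then have "s \<in> carrier G" using SG by blast
    then have "conjugate G h (inv s) = inv (conjugate G h s)"
      using h by (simp add: group_word_simps)
    then show ?case using S[OF inv] subgroup.m_inv_closed[OF sub] by simp
  next
    case (eng x y)
    then have "x \<in> carrier G" "y \<in> carrier G" using generate_in_carrier[OF SG] by blast+
    then have "conjugate G h (x \<otimes> y) = conjugate G h x \<otimes> conjugate G h y"
      using h by (simp add: group_word_simps)
    then show ?case using eng.IH by (simp only: generate.eng)
  qed
qed

text \<open>
  For \<open>b \<in> B\<close> the normal subgroup \<open>W\<close> generated by the \<open>[b, g]\<close> has at most \<open>n = |G / N|\<close> generators, each of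
  order dividing \<open>n\<^sup>k\<close>, so \<open>|W|\<close>, and with it the index of a term of the upper central series containing \<open>W\<close>, is bounded
  independently of \<open>b\<close>. This uniformity is
  the point: \<open>B\<close> need not be finitely generated.
\<close>

theorem unipotent_abelian_subset_upper_central:
  assumes B: "B \<lhd> G" and ab: "\<And>x y. x \<in> B \<Longrightarrow> y \<in> B \<Longrightarrow> x \<otimes> y = y \<otimes> x"
    and N: "N \<lhd> G" and fin: "finite (carrier (G Mod N))"
    and triv: "\<And>x y. x \<in> N \<Longrightarrow> y \<in> B \<Longrightarrow> x \<otimes> y = y \<otimes> x"
    and unip: "\<And>g. g \<in> carrier G \<Longrightarrow> B \<subseteq> iterated_centralizer G {g} {\<one>} k"
  shows "\<exists>r. B \<subseteq> upper_central G r"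
proof -
  interpret B: normal B G by fact
  interpret N: normal N G by fact
  interpret q: group_hom G "G Mod N" "(#>) N" by (rule N.coset_group_hom)
  define n where "n = card (carrier (G Mod N))"
  have "n > 0" using fin q.H.one_closed by (auto simp: n_def card_gt_0_iff)
  have gn: "g [^] n \<in> N" if g: "g \<in> carrier G" for g
  proof -
    have "N #> (g [^] n) = \<one>\<^bsub>G Mod N\<^esub>"
      using q.H.pow_order_eq_1[of "N #> g"] g N.FactGroup_pow[OF g, of n]
      by (simp add: n_def Coset.order_def)
    then show ?thesis using N.coset_eq_self_iff g by simp
  qed
  have "b \<in> upper_central G (Suc ((n ^ k) ^ n))" if b: "b \<in> B" for b
  proof -
    have bG: "b \<in> carrier G" using b B.subset by auto
    let ?S = "{commutator G b g | g. g \<in> carrier G}"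
    let ?W = "generate G ?S"
    have SB: "?S \<subseteq> B" using commutator_in_normal_left[OF B b] by auto
    have WB: "?W \<subseteq> B" using SB B.subgroup_axioms by (rule generate_subgroup_incl)
    have W: "?W \<lhd> G" using bG by (rule generate_commutators_of_element_normal)
    (* [b, x g] = [b, g] for x in N, so one representative of each coset gives all of ?S. *)
    define rep where "rep R = (SOME g. g \<in> R)" for R :: "'a set"
    have "?S \<subseteq> (\<lambda>R. commutator G b (rep R)) ` carrier (G Mod N)"
    proof
      fix s assume "s \<in> ?S"
      then obtain g where g: "s = commutator G b g" "g \<in> carrier G" by blast
      have "rep (N #> g) \<in> N #> g"
        unfolding rep_def using rcos_self[OF g(2) N.subgroup_axioms] by (rule someI)
      then obtain x where x: "x \<in> N" "rep (N #> g) = x \<otimes> g" by (auto simp: r_coset_def)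
      have xG: "x \<in> carrier G" using x N.subset by auto
      have "commutator G b x = \<one>" using triv[OF x(1) b] xG bG by (simp add: commutator_eq_one_iff)
      then have "commutator G b (rep (N #> g)) = s"
        using x(2) xG bG g by (simp add: commutator_mult_right)
      then show "s \<in> (\<lambda>R. commutator G b (rep R)) ` carrier (G Mod N)"
        using g(2) q.hom_closed by blast
    qed
    then have S: "finite ?S" "card ?S \<le> n"
      using fin surj_card_le[OF fin] by (auto simp: n_def intro: finite_surj)
    have "finite ?W \<and> card ?W \<le> (n ^ k) ^ card ?S"
    proof (rule finite_generate_of_bounded_exponent[OF S(1)])
      show "?S \<subseteq> carrier G" "0 < n ^ k" using bG \<open>n > 0\<close> by auto
      show "x \<otimes> y = y \<otimes> x" if "x \<in> ?W" "y \<in> ?W" for x y using ab WB that by blast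
      show "s [^] (n ^ k) = \<one>" if "s \<in> ?S" for s
      proof -
        obtain g where g: "s = commutator G b g" "g \<in> carrier G" using \<open>s \<in> ?S\<close> by blast
        have "b \<in> iterated_centralizer G {g} {\<one>} (Suc k)"
          using unip[OF g(2)] b g(2) iterated_centralizer_one_increasing[of "{g}" k "Suc k"] by auto
        then show ?thesis
          unfolding g(1) using triv[OF gn[OF g(2)]] by (intro commutator_torsion[OF B ab g(2) _ b]) auto
      qed
    qed
    moreover have "(n ^ k) ^ card ?S \<le> (n ^ k) ^ n"
      using S(2) \<open>n > 0\<close> by (intro power_increasing) auto
    ultimately have fW: "finite ?W" and cW: "card ?W \<le> (n ^ k) ^ n" by auto
    have "?W \<subseteq> upper_central G (card ?W)"
      using WB unip ab by (intro unipotent_finite_abelian_subset_upper_central[OF W fW, of k]) blast+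
    then have "?W \<subseteq> upper_central G ((n ^ k) ^ n)"
      using upper_central_increasing[OF cW] by blast
    then show ?thesis
      unfolding upper_central_Suc_iff using bG generate.incl[of _ ?S G] by blast
  qed
  then show ?thesis by blast
qed

text \<open>
  The abelian case is applied to the factors of the series \<open>A i = M \<inter> Z\<^sub>i(N)\<close>. On these \<open>N\<close> acts trivially, so that unipotency
  of one element of a coset \<open>N x\<close> gives unipotency of \<open>x\<close>.
\<close>

theorem unipotent_nilpotent_subset_upper_central:
  assumes N: "N \<lhd> G" and fin: "finite (carrier (G Mod N))"
    and nilp: "N \<subseteq> iterated_centralizer G N {\<one>} c"
    and M: "M \<lhd> G" "M \<subseteq> N"
    and unip: "\<And>x. x \<in> carrier G \<Longrightarrow> \<exists>g \<in> N #> x. M \<subseteq> iterated_centralizer G {g} {\<one>} k"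
  shows "\<exists>r. M \<subseteq> upper_central G r"
proof -
  interpret N: normal N G by fact
  interpret M: normal M G by fact
  define A where "A i = M \<inter> iterated_centralizer G N {\<one>} i" for i
  have A_normal: "A i \<lhd> G" for i
    unfolding A_def by (intro normal_subgroup_intersect M iterated_centralizer_normal one_is_normal N)
  have A_M: "a \<in> M" if "a \<in> A i" for a i
    using that unfolding A_def by blast
  have A_iter: "A i \<subseteq> iterated_centralizer G N {\<one>} i" for i
    unfolding A_def by blast
  have A_comm: "commutator G a x \<in> A i" if ax: "a \<in> A (Suc i)" "x \<in> N" for a x i
  proof -
    have "x \<in> carrier G" using ax(2) N.subset by blast
    then have "commutator G a x \<in> M" using A_M[OF ax(1)] by (rule commutator_in_normal_left[OF M(1), rotated])
    moreover have "commutator G a x \<in> iterated_centralizer G N {\<one>} i"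
      using A_iter[of "Suc i"] ax by auto
    ultimately show ?thesis unfolding A_def by blast
  qed
  have "\<exists>r. A i \<subseteq> upper_central G r" for i
  proof (induction i)
    case 0
    have "A 0 \<subseteq> upper_central G 0" by (auto simp: A_def)
    then show ?case ..
  next
    case (Suc i)
    then obtain r where r: "A i \<subseteq> upper_central G r" by blast
    interpret A: normal "A i" G by (rule A_normal)
    interpret A': normal "A (Suc i)" G by (rule A_normal)
    interpret q: group_hom G "G Mod A i" "(#>) (A i)" by (rule A.coset_group_hom)
    have coset_mult_right: "A i #> (y \<otimes> a) = A i #> y" if "y \<in> carrier G" "a \<in> A i" for y a
    proof -
      have "inv y \<otimes> (y \<otimes> a) \<in> A i" using that A.subset by (auto simp: mult_inv_cancel)
      then show ?thesis using that A.subset A.coset_eq_iff[of "y \<otimes> a" y] by auto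
    qed
    let ?B = "(#>) (A i) ` A (Suc i)" and ?N = "(#>) (A i) ` N"
    have surj: "(#>) (A i) ` carrier G = carrier (G Mod A i)" by (simp add: carrier_FactGroup)
    have triv: "x \<otimes>\<^bsub>G Mod A i\<^esub> y = y \<otimes>\<^bsub>G Mod A i\<^esub> x" if xy: "x \<in> ?N" "y \<in> ?B" for x y
    proof -
      obtain a b where ab: "x = A i #> a" "y = A i #> b" "a \<in> N" "b \<in> A (Suc i)" using xy by blast
      then have "a \<in> carrier G" "b \<in> carrier G" using N.subset A'.subset by blast+
      then show ?thesis
        using A.cosets_commute_iff[of b a] A_comm[OF ab(4,3)] unfolding ab(1,2) by metis
    qed
    have BN: "?B \<subseteq> ?N" using M(2) A_M by blast
    have "\<exists>r'. ?B \<subseteq> upper_central (G Mod A i) r'"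
    proof (rule q.H.unipotent_abelian_subset_upper_central[OF _ _ _ _ triv])
      show "?B \<lhd> G Mod A i" by (rule A'.surj_hom_normal_subgroup[OF q.group_hom_axioms surj])
      show "?N \<lhd> G Mod A i" by (rule N.surj_hom_normal_subgroup[OF q.group_hom_axioms surj])
      show "x \<otimes>\<^bsub>G Mod A i\<^esub> y = y \<otimes>\<^bsub>G Mod A i\<^esub> x" if "x \<in> ?B" "y \<in> ?B" for x y
        by (rule triv[OF subsetD[OF BN that(1)] that(2)])
      show "finite (carrier ((G Mod A i) Mod ?N))"
      proof -
        have "?N #>\<^bsub>G Mod A i\<^esub> (A i #> x) = (#>) (A i) ` (N #> x)" if "x \<in> carrier G" for x
          using that N.subset by (force simp: r_coset_def[of "G Mod A i"] r_coset_def[of G N] q.hom_mult)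
        then have "carrier ((G Mod A i) Mod ?N) \<subseteq> (\<lambda>R. (#>) (A i) ` R) ` carrier (G Mod N)"
          by (auto simp: carrier_FactGroup)
        then show ?thesis using fin by (rule finite_surj[rotated])
      qed
      show "?B \<subseteq> iterated_centralizer (G Mod A i) {x'} {\<one>\<^bsub>G Mod A i\<^esub>} k"
        if x': "x' \<in> carrier (G Mod A i)" for x'
      proof -
        obtain x where x: "x \<in> carrier G" "x' = A i #> x" using x' by (auto simp: carrier_FactGroup)
        obtain g where g: "g \<in> N #> x" "M \<subseteq> iterated_centralizer G {g} {\<one>} k" using unip[OF x(1)] by blast
        obtain h where h: "h \<in> N" "g = h \<otimes> x" using g by (auto simp: r_coset_def)
        have hG: "h \<in> carrier G" using h N.subset by auto
        have gG: "{g} \<subseteq> carrier G" using h(2) hG x(1) by simp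
        have same: "b \<in> iterated_centralizer G {x} (A i) j"
          if "b \<in> A (Suc i)" "b \<in> iterated_centralizer G {g} (A i) j" for b j
          using that
        proof (induction j arbitrary: b)
          case (Suc j)
          have bG: "b \<in> carrier G" using Suc.prems A'.subset by auto
          (* With g = h x one has [b, g] = [b, x] [b, h]^x, and [b, h] lies in A i. *)
          let ?y = "commutator G b x" and ?a = "conjugate G x (commutator G b h)"
          have a: "?a \<in> A i"
            using A_comm[OF Suc.prems(1) h(1)] x(1) by (simp add: A.inv_op_closed1)
          have "commutator G b g = ?y \<otimes> ?a"
            using bG hG x(1) h(2) by (simp add: commutator_mult_right)
          then have y: "A i #> ?y = A i #> commutator G b g"
            using coset_mult_right[OF _ a, of ?y] bG x(1) by simp
          have "commutator G b g \<in> iterated_centralizer G {g} (A i) j"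
            using Suc.prems(2) by simp
          then have "?y \<in> iterated_centralizer G {g} (A i) j"
            using A.iterated_centralizer_coset_iff[OF _ gG, of ?y j]
              A.iterated_centralizer_coset_iff[OF _ gG, of "commutator G b g" j] y bG x(1) gG
            by (simp del: one_FactGroup)
          moreover have "?y \<in> A (Suc i)"
            using Suc.prems(1) x(1) by (rule commutator_in_normal_left[OF A_normal])
          ultimately have "?y \<in> iterated_centralizer G {x} (A i) j" by (intro Suc.IH)
          then show ?case using bG by simp
        qed simp
        show ?thesis
        proof
          fix b' assume "b' \<in> ?B"
          then obtain b where b: "b \<in> A (Suc i)" "b' = A i #> b" by blast
          have "b \<in> iterated_centralizer G {g} (A i) k"
            using g(2) A_M[OF b(1)] iterated_centralizer_mono[of "{g}" "{g}" "{\<one>}" "A i" k] A.one_closed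
            by blast
          then have "b \<in> iterated_centralizer G {x} (A i) k" using same[OF b(1)] by blast
          then show "b' \<in> iterated_centralizer (G Mod A i) {x'} {\<one>\<^bsub>G Mod A i\<^esub>} k"
            using A.iterated_centralizer_coset_iff[of b "{x}" k] b x A'.subset by auto
        qed
      qed
    qed
    then obtain r' where r': "?B \<subseteq> upper_central (G Mod A i) r'" by blast
    have "A (Suc i) \<subseteq> upper_central G (r' + r)"
    proof
      fix a assume a: "a \<in> A (Suc i)"
      then have aG: "a \<in> carrier G" using A'.subset by auto
      have "a \<in> iterated_centralizer G (carrier G) (A i) r'"
        using r' a A.iterated_centralizer_coset_iff[OF aG subset_refl, of r']
        unfolding q.H.upper_central_eq surj by blast
      then show "a \<in> upper_central G (r' + r)"
        using iterated_centralizer_mono[OF subset_refl r, of "carrier G" r']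
        unfolding upper_central_eq iterated_centralizer_add by blast
    qed
    then show ?case by blast
  qed
  from this[of c] show ?thesis using nilp M(2) by (simp add: A_def inf.absorb1)
qed

end

section \<open>Open subgroups of profinite groups\<close>

context topological_group
begin

lemma continuous_map_mult:
  assumes "continuous_map X T f" "continuous_map X T g"
  shows "continuous_map X T (\<lambda>x. f x \<otimes> g x)"
  using continuous_map_compose[OF continuous_map_pairedI[OF assms] continuous_mult] by (simp add: o_def)

lemma continuous_map_inverse:
  assumes "continuous_map X T f"
  shows "continuous_map X T (\<lambda>x. inv (f x))"
  using continuous_map_compose[OF assms continuous_inv] by (simp add: o_def)

lemma continuous_map_constant: "a \<in> carrier G \<Longrightarrow> continuous_map X T (\<lambda>x. a)"
  by (simp add: topspace_eq_carrier)

lemma continuous_map_ident: "continuous_map T T (\<lambda>x. x)"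
  using continuous_map_id[of T] by (simp add: id_def)

lemmas continuous_map_group_ops =
  continuous_map_mult continuous_map_inverse continuous_map_constant continuous_map_ident

lemma openin_preimage:
  assumes "openin T U" "continuous_map T T f"
  shows "openin T {x \<in> carrier G. f x \<in> U}"
  using openin_continuous_map_preimage[OF assms(2,1)] by (simp add: topspace_eq_carrier)

lemma closedin_preimage:
  assumes "closedin T C" "continuous_map T T f"
  shows "closedin T {x \<in> carrier G. f x \<in> C}"
  using closedin_continuous_map_preimage[OF assms(2,1)] by (simp add: topspace_eq_carrier)

lemma iterated_centralizer_closed:
  assumes S: "S \<subseteq> carrier G" and K: "closedin T K"
  shows "closedin T (iterated_centralizer G S K n)"
proof (induction n)
  case (Suc n)
  let ?Z = "iterated_centralizer G S K n"
  show ?case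
  proof (cases "S = {}")
    case True
    then show ?thesis using closedin_topspace[of T] by (simp add: topspace_eq_carrier)
  next
    case False
    have "closedin T {x \<in> carrier G. commutator G x s \<in> ?Z}" if "s \<in> S" for s
      using that S Suc unfolding commutator_def
      by (intro closedin_preimage continuous_map_group_ops) auto
    then have "closedin T (\<Inter>s\<in>S. {x \<in> carrier G. commutator G x s \<in> ?Z})"
      using False by (intro closedin_INT) auto
    also have "(\<Inter>s\<in>S. {x \<in> carrier G. commutator G x s \<in> ?Z}) = iterated_centralizer G S K (Suc n)"
      using False by auto
    finally show ?thesis .
  qed
qed (simp add: K)

text \<open>
  For fixed \<open>x\<close>, the condition that \<open>[x, s]\<close> lies in a given closed set is closed in \<open>s\<close>; so each variable \<open>s\<^sub>i\<close> in turn may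
  range over the closure.
\<close>

lemma iterated_centralizer_closure:
  assumes S: "S \<subseteq> carrier G" and K: "closedin T K"
  shows "iterated_centralizer G (T closure_of S) K n = iterated_centralizer G S K n"
proof (induction n)
  case (Suc n)
  let ?Z = "iterated_centralizer G S K n"
  have "T closure_of S \<subseteq> {s \<in> carrier G. commutator G x s \<in> ?Z}"
    if x: "x \<in> iterated_centralizer G S K (Suc n)" for x
  proof (rule closure_of_minimal)
    show "S \<subseteq> {s \<in> carrier G. commutator G x s \<in> ?Z}" using x S by auto
    show "closedin T {s \<in> carrier G. commutator G x s \<in> ?Z}"
      unfolding commutator_def using x iterated_centralizer_closed[OF S K]
      by (intro closedin_preimage continuous_map_group_ops) auto
  qed
  moreover have "S \<subseteq> T closure_of S" using S by (intro closure_of_subset) (simp add: topspace_eq_carrier)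
  ultimately show ?case by (auto simp: Suc)
qed simp

lemma closure_of_subgroup:
  assumes H: "subgroup H G"
  shows "subgroup (T closure_of H) G"
proof (rule subgroupI)
  have HG: "H \<subseteq> carrier G" using H by (rule subgroup.subset)
  show sub: "T closure_of H \<subseteq> carrier G"
    using closure_of_subset_topspace[of T H] by (simp add: topspace_eq_carrier)
  have "H \<subseteq> T closure_of H" using HG by (intro closure_of_subset) (simp add: topspace_eq_carrier)
  then show "T closure_of H \<noteq> {}" using subgroup.one_closed[OF H] by blast
  have "(\<lambda>x. inv x) ` (T closure_of H) \<subseteq> T closure_of (\<lambda>x. inv x) ` H"
    by (rule continuous_map_image_closure_subset[OF continuous_inv])
  also have "\<dots> \<subseteq> T closure_of H"
    using subgroup.m_inv_closed[OF H] by (intro closure_of_mono) auto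
  finally show "inv a \<in> T closure_of H" if "a \<in> T closure_of H" for a using that by blast
  have "(\<lambda>(x, y). x \<otimes> y) ` ((T closure_of H) \<times> (T closure_of H))
      \<subseteq> T closure_of (\<lambda>(x, y). x \<otimes> y) ` (H \<times> H)"
    using continuous_map_image_closure_subset[OF continuous_mult, of "H \<times> H"]
    by (simp add: closure_of_Times)
  also have "\<dots> \<subseteq> T closure_of H"
    using subgroup.m_closed[OF H] by (intro closure_of_mono) auto
  finally show "a \<otimes> b \<in> T closure_of H" if "a \<in> T closure_of H" "b \<in> T closure_of H" for a b
    using that by blast
qed

lemma open_subgroup_of_interior:
  assumes H: "subgroup H G" and U: "openin T U" "U \<subseteq> H" "U \<noteq> {}"
  shows "openin T H"
  unfolding openin_subopen[of T H]
proof
  fix h assume h: "h \<in> H"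
  interpret H: subgroup H G by fact
  obtain x where x: "x \<in> U" using U by blast
  then have xH: "x \<in> H" using U by blast
  let ?V = "{y \<in> carrier G. x \<otimes> (inv h \<otimes> y) \<in> U}"
  have "openin T ?V"
    using U(1) xH h by (intro openin_preimage continuous_map_group_ops) auto
  moreover have "h \<in> ?V" using h xH x by simp
  moreover have "?V \<subseteq> H"
  proof
    fix y assume y: "y \<in> ?V"
    then have "x \<otimes> (inv h \<otimes> y) \<in> H" using U by blast
    then have "h \<otimes> (inv x \<otimes> (x \<otimes> (inv h \<otimes> y))) \<in> H" using h xH by simp
    then show "y \<in> H" using y h xH by (simp add: mult_inv_cancel)
  qed
  ultimately show "\<exists>V. openin T V \<and> h \<in> V \<and> V \<subseteq> H" by blast
qed

lemma coset_eq_preimage: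
  assumes "N \<subseteq> carrier G" "x \<in> carrier G"
  shows "N #> x = {y \<in> carrier G. y \<otimes> inv x \<in> N}"
proof (intro subset_antisym subsetI)
  fix y assume "y \<in> {y \<in> carrier G. y \<otimes> inv x \<in> N}"
  then show "y \<in> N #> x"
    using assms unfolding r_coset_def by (auto simp: m_assoc intro!: bexI[of _ "y \<otimes> inv x"])
qed (use assms in \<open>auto simp: r_coset_def m_assoc\<close>)

lemma open_coset:
  assumes "openin T N" "N \<subseteq> carrier G" "x \<in> carrier G"
  shows "openin T (N #> x)"
  using assms unfolding coset_eq_preimage[OF assms(2,3)]
  by (intro openin_preimage continuous_map_group_ops) auto

lemma closed_coset:
  assumes "closedin T N" "N \<subseteq> carrier G" "x \<in> carrier G"
  shows "closedin T (N #> x)"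
  using assms unfolding coset_eq_preimage[OF assms(2,3)]
  by (intro closedin_preimage continuous_map_group_ops) auto

lemma open_subgroup_closed:
  assumes N: "subgroup N G" "openin T N"
  shows "closedin T N"
  unfolding closedin_def
proof
  have NG: "N \<subseteq> carrier G" using N(1) by (rule subgroup.subset)
  then show "N \<subseteq> topspace T" by (simp add: topspace_eq_carrier)
  show "openin T (topspace T - N)"
    unfolding openin_subopen[of T "topspace T - N"]
  proof
    fix y assume "y \<in> topspace T - N"
    then have y: "y \<in> carrier G" "y \<notin> N" by (auto simp: topspace_eq_carrier)
    have "z \<notin> N" if "z \<in> N #> y" for z
    proof
      assume z: "z \<in> N"
      obtain n where n: "n \<in> N" "z = n \<otimes> y" using \<open>z \<in> N #> y\<close> by (auto simp: r_coset_def)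
      then have "inv n \<otimes> z = y" using NG y(1) by (auto simp: mult_inv_cancel)
      then show False
        using y(2) z n(1) subgroup.m_closed[OF N(1) subgroup.m_inv_closed[OF N(1) n(1)] z] by simp
    qed
    moreover have "N #> y \<subseteq> topspace T"
      using NG y(1) by (simp add: topspace_eq_carrier r_coset_subset_G)
    ultimately show "\<exists>V. openin T V \<and> y \<in> V \<and> V \<subseteq> topspace T - N"
      using open_coset[OF N(2) NG y(1)] rcos_self[OF y(1) N(1)] by (intro exI[of _ "N #> y"]) blast
  qed
qed

lemma finite_quotient_of_open:
  assumes compact: "compact_space T" and N: "N \<lhd> G" "openin T N"
  shows "finite (carrier (G Mod N))"
proof -
  interpret N: normal N G by fact
  have "openin T R" if "R \<in> rcosets N" for R
    using that N open_coset N.subset unfolding RCOSETS_def by auto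
  moreover have "\<Union>(rcosets N) = topspace T"
    using rcosets_part_G[OF N.subgroup_axioms] by (simp add: topspace_eq_carrier)
  ultimately obtain \<F> where F: "finite \<F>" "\<F> \<subseteq> rcosets N" "\<Union>\<F> = topspace T"
    using compact unfolding compact_space by meson
  have "rcosets N \<subseteq> \<F>"
  proof
    fix R assume R: "R \<in> rcosets N"
    then obtain x where x: "x \<in> R" using N.rcosets_non_empty by blast
    moreover have "x \<in> topspace T"
      using x R rcosets_part_G[OF N.subgroup_axioms] by (auto simp: topspace_eq_carrier)
    ultimately obtain R' where R': "R' \<in> \<F>" "x \<in> R'" using F by blast
    then have "R = R'"
      using rcos_disjoint[OF N.subgroup_axioms] R F(2) x unfolding pairwise_def disjnt_def by blast
    then show "R \<in> \<F>" using R' by simp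
  qed
  then show ?thesis using F(1) finite_subset by (auto simp: FactGroup_def)
qed

text \<open>
  The elements that may be inserted into or removed from any product without affecting membership in
  \<open>U\<close> form a normal subgroup contained in \<open>U\<close> (the syntactic congruence class of \<open>1\<close>). The tube lemma, applied to the triples
  \<open>(x, (g, h))\<close> for which \<open>g x h\<close> and \<open>g h\<close> are both in \<open>U\<close> or both outside, shows that it contains a
  neighbourhood of \<open>1\<close>.
\<close>

lemma exists_open_normal_subgroup:
  assumes compact: "compact_space T"
    and U: "openin T U" "closedin T U" "\<one> \<in> U"
  shows "\<exists>N. N \<lhd> G \<and> openin T N \<and> N \<subseteq> U"
proof -
  define N where
    "N = {x \<in> carrier G. \<forall>g\<in>carrier G. \<forall>h\<in>carrier G. g \<otimes> x \<otimes> h \<in> U \<longleftrightarrow> g \<otimes> h \<in> U}"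
  let ?X = "prod_topology T (prod_topology T T)"
  define W where "W = {p \<in> topspace ?X.
      fst (snd p) \<otimes> fst p \<otimes> snd (snd p) \<in> U \<longleftrightarrow> fst (snd p) \<otimes> snd (snd p) \<in> U}"
  have proj: "continuous_map ?X T fst" "continuous_map ?X T (\<lambda>p. fst (snd p))"
      "continuous_map ?X T (\<lambda>p. snd (snd p))"
    using continuous_map_fst continuous_map_snd
      continuous_map_compose[OF continuous_map_snd continuous_map_fst]
      continuous_map_compose[OF continuous_map_snd continuous_map_snd] by (auto simp: o_def)
  have "W = ({p \<in> topspace ?X. fst (snd p) \<otimes> fst p \<otimes> snd (snd p) \<in> U}
              \<inter> {p \<in> topspace ?X. fst (snd p) \<otimes> snd (snd p) \<in> U})
          \<union> ({p \<in> topspace ?X. fst (snd p) \<otimes> fst p \<otimes> snd (snd p) \<in> topspace T - U}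
              \<inter> {p \<in> topspace ?X. fst (snd p) \<otimes> snd (snd p) \<in> topspace T - U})"
    by (auto simp: W_def topspace_eq_carrier)
  also have "openin ?X \<dots>"
    using U by (intro openin_Un openin_Int openin_continuous_map_preimage[of ?X T] continuous_map_mult proj)
      auto
  finally have W: "openin ?X W" .
  have "compactin (prod_topology T T) (topspace (prod_topology T T))"
    using compact compact_space_prod_topology[of T T] by (simp add: compact_space_def)
  moreover have "{\<one>} \<times> topspace (prod_topology T T) \<subseteq> W"
    by (auto simp: W_def topspace_eq_carrier)
  ultimately obtain V V' where "openin T V" "\<one> \<in> V"
      "topspace (prod_topology T T) \<subseteq> V'" "V \<times> V' \<subseteq> W"
    using tube_lemma_right[OF W, of "topspace (prod_topology T T)" \<one>] topspace_eq_carrier by auto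
  then have V: "openin T V" "\<one> \<in> V" "V \<times> topspace (prod_topology T T) \<subseteq> W" by blast+
  have VG: "V \<subseteq> carrier G" using openin_subset[OF V(1)] by (simp add: topspace_eq_carrier)
  have VN: "V \<subseteq> N"
  proof
    fix x assume x: "x \<in> V"
    have "g \<otimes> x \<otimes> h \<in> U \<longleftrightarrow> g \<otimes> h \<in> U" if "g \<in> carrier G" "h \<in> carrier G" for g h
    proof -
      have "(x, (g, h)) \<in> W" using V(3) x that by (auto simp: topspace_eq_carrier)
      then show ?thesis by (simp add: W_def)
    qed
    then show "x \<in> N" using x VG by (auto simp: N_def)
  qed
  have N_iff: "g \<otimes> x \<otimes> h \<in> U \<longleftrightarrow> g \<otimes> h \<in> U"
    if "x \<in> N" "g \<in> carrier G" "h \<in> carrier G" for x g h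
    using that by (simp add: N_def)
  have NG: "N \<subseteq> carrier G" by (auto simp: N_def)
  have "subgroup N G"
  proof (rule subgroupI)
    show "N \<subseteq> carrier G" "N \<noteq> {}" using NG VN V(2) by auto
  next
    fix x assume x: "x \<in> N"
    then have xG: "x \<in> carrier G" using NG by blast
    have "g \<otimes> inv x \<otimes> h \<in> U \<longleftrightarrow> g \<otimes> h \<in> U" if "g \<in> carrier G" "h \<in> carrier G" for g h
      using N_iff[OF x, of "g \<otimes> inv x" h] that xG by (simp add: m_assoc mult_inv_cancel)
    then show "inv x \<in> N" using xG by (simp add: N_def)
  next
    fix x y assume xy: "x \<in> N" "y \<in> N"
    then have G: "x \<in> carrier G" "y \<in> carrier G" using NG by auto
    have "g \<otimes> (x \<otimes> y) \<otimes> h \<in> U \<longleftrightarrow> g \<otimes> h \<in> U" if "g \<in> carrier G" "h \<in> carrier G" for g h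
      using N_iff[OF xy(1), of g "y \<otimes> h"] N_iff[OF xy(2), of g h] that G by (simp add: m_assoc)
    then show "x \<otimes> y \<in> N" using G by (simp add: N_def)
  qed
  then have "N \<lhd> G"
  proof (rule normalI_conjugate)
    fix a x assume a: "a \<in> carrier G" and x: "x \<in> N"
    then have xG: "x \<in> carrier G" using NG by blast
    have "g \<otimes> conjugate G a x \<otimes> h \<in> U \<longleftrightarrow> g \<otimes> h \<in> U"
      if "g \<in> carrier G" "h \<in> carrier G" for g h
      using N_iff[OF x, of "g \<otimes> inv a" "a \<otimes> h"] that a xG by (simp add: m_assoc mult_inv_cancel)
    then show "conjugate G a x \<in> N" using a xG by (simp add: N_def)
  qed
  moreover have "openin T N"
    using \<open>subgroup N G\<close> V(1) VN V(2) by (intro open_subgroup_of_interior[of N V]) auto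
  moreover have "N \<subseteq> U"
  proof
    fix x assume x: "x \<in> N"
    then show "x \<in> U" using N_iff[OF x, of \<one> \<one>] NG U(3) by auto
  qed
  ultimately show ?thesis by blast
qed

end

context profinite_group
begin

text \<open>
  In a compact Hausdorff space the intersection of the clopen sets containing a point is its connected
  component.
\<close>

lemma exists_clopen_separating:
  assumes y: "y \<in> carrier G" "y \<noteq> \<one>"
  shows "\<exists>U. openin T U \<and> closedin T U \<and> \<one> \<in> U \<and> y \<notin> U"
proof -
  have "quasi_component_of T \<one> = connected_component_of T \<one>"
    using compact Hausdorff by (intro quasi_eq_connected_component_of) auto
  moreover have "\<not> connected_component_of T \<one> y"
  proof
    assume "connected_component_of T \<one> y"
    then obtain S where S: "connectedin T S" "\<one> \<in> S" "y \<in> S"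
      by (auto simp: connected_component_of_def)
    then show False
      using totally_disconnected y(2) unfolding totally_disconnected_space_def by blast
  qed
  ultimately have "\<not> quasi_component_of T \<one> y" by simp
  then show ?thesis
    using y(1) by (auto simp: quasi_component_of topspace_eq_carrier)
qed

lemma exists_open_normal_avoiding:
  assumes "finite K" "K \<subseteq> carrier G"
  shows "\<exists>N. N \<lhd> G \<and> openin T N \<and> N \<inter> K \<subseteq> {\<one>}"
proof -
  have "\<exists>U. openin T U \<and> closedin T U \<and> \<one> \<in> U \<and> U \<inter> K \<subseteq> {\<one>}"
    using assms
  proof (induction K)
    case empty
    show ?case
      using openin_topspace[of T] closedin_topspace[of T]
      by (intro exI[of _ "carrier G"]) (simp add: topspace_eq_carrier)
  next
    case (insert y K)
    then obtain U where U: "openin T U" "closedin T U" "\<one> \<in> U" "U \<inter> K \<subseteq> {\<one>}" by auto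
    show ?case
    proof (cases "y = \<one>")
      case True
      then show ?thesis using U by auto
    next
      case False
      then obtain V where "openin T V" "closedin T V" "\<one> \<in> V" "y \<notin> V"
        using exists_clopen_separating insert.prems by auto
      then show ?thesis using U by (intro exI[of _ "U \<inter> V"]) auto
    qed
  qed
  then obtain U where U: "openin T U" "closedin T U" "\<one> \<in> U" "U \<inter> K \<subseteq> {\<one>}" by blast
  then obtain N where "N \<lhd> G" "openin T N" "N \<subseteq> U"
    using exists_open_normal_subgroup[OF compact] by blast
  then show ?thesis using U(4) by blast
qed

end

section \<open>Proof of the equivalence\<close>

context group
begin

text \<open>
  The preimage of a cyclic subgroup of \<open>G / Z\<^sub>m(G)\<close> is abelian modulo \<open>Z\<^sub>m(G)\<close>.
\<close>

lemma finite_nilpotent_cover_of_finite_index_upper_central: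
  assumes fin: "finite (carrier (G Mod upper_central G m))"
  shows "\<exists>\<H>. finite \<H> \<and> (\<forall>H\<in>\<H>. subgroup H G \<and> nilpotent_group (G\<lparr>carrier := H\<rparr>)) \<and> \<Union>\<H> = carrier G"
proof -
  let ?Z = "upper_central G m"
  interpret Z: normal ?Z G by (rule upper_central_normal)
  interpret q: group_hom G "G Mod ?Z" "(#>) ?Z" by (rule Z.coset_group_hom)
  define H where "H R = {x \<in> carrier G. ?Z #> x \<in> generate (G Mod ?Z) {R}}" for R
  have sub: "subgroup (H R) G" if R: "R \<in> carrier (G Mod ?Z)" for R
  proof -
    interpret C: subgroup "generate (G Mod ?Z) {R}" "G Mod ?Z"
      using R by (intro q.H.generate_is_subgroup) simp
    show ?thesis
    proof (rule subgroupI)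
      show "H R \<noteq> {}" using C.one_closed q.hom_one by (auto simp: H_def intro!: exI[of _ \<one>])
      show "inv x \<in> H R" if "x \<in> H R" for x
        using that C.m_inv_closed[of "?Z #> x"] by (auto simp: H_def)
      show "x \<otimes> y \<in> H R" if "x \<in> H R" "y \<in> H R" for x y
        using that C.m_closed[of "?Z #> x" "?Z #> y"] q.hom_mult[of x y] by (auto simp: H_def)
    qed (auto simp: H_def)
  qed
  have nilp: "nilpotent_group (G\<lparr>carrier := H R\<rparr>)" if R: "R \<in> carrier (G Mod ?Z)" for R
  proof -
    have comm: "commutator G x y \<in> ?Z" if xy: "x \<in> H R" "y \<in> H R" for x y
    proof -
      obtain i j :: int where ij: "?Z #> x = R [^]\<^bsub>G Mod ?Z\<^esub> i" "?Z #> y = R [^]\<^bsub>G Mod ?Z\<^esub> j"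
        using xy R by (auto simp: H_def q.H.generate_pow)
      have "(?Z #> x) \<otimes>\<^bsub>G Mod ?Z\<^esub> (?Z #> y) = (?Z #> y) \<otimes>\<^bsub>G Mod ?Z\<^esub> (?Z #> x)"
        unfolding ij using R by (metis q.H.int_pow_mult add.commute)
      then show ?thesis using Z.cosets_commute_iff[of x y] xy by (simp add: H_def)
    qed
    have "?Z \<subseteq> iterated_centralizer G (H R) {\<one>} m"
      unfolding upper_central_eq by (rule iterated_centralizer_mono) (auto simp: H_def)
    then have "H R \<subseteq> iterated_centralizer G (H R) {\<one>} (Suc m)"
      using comm by (auto simp: H_def)
    then show ?thesis using nilpotent_subgroup_iff[OF sub[OF R]] by blast
  qed
  have "x \<in> H (?Z #> x)" if "x \<in> carrier G" for x
    using that by (auto simp: H_def intro: generate.incl)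
  then have "\<Union>(H ` carrier (G Mod ?Z)) = carrier G"
    using q.hom_closed by (force simp: H_def)
  then show ?thesis using fin sub nilp by (intro exI[of _ "H ` carrier (G Mod ?Z)"]) auto
qed

lemma normal_inter_iterated_centralizer:
  assumes N: "N \<lhd> G" "S \<subseteq> carrier G"
  shows "N \<inter> iterated_centralizer G S K n \<subseteq> iterated_centralizer G S (N \<inter> K) n"
proof (induction n)
  case (Suc n)
  show ?case
    using commutator_in_normal_left[OF N(1)] N(2) by (auto intro!: subsetD[OF Suc])
qed simp

end

context topological_group
begin

lemma open_upper_central_of_open_subset:
  assumes "openin T N" "N \<noteq> {}" "N \<subseteq> upper_central G r"
  shows "openin T (upper_central G r)"
  using open_subgroup_of_interior[OF normal_imp_subgroup[OF upper_central_normal]] assms by blast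

end

context profinite_group
begin

text \<open>
  The traces of the cover on \<open>X\<close> are closed sets whose union is the nonempty open set \<open>X\<close>, so not all of them
  have empty interior.
\<close>

lemma baire_closed_cover:
  assumes C: "countable \<C>" "\<And>C. C \<in> \<C> \<Longrightarrow> closedin T C" "X \<subseteq> \<Union>\<C>"
    and X: "openin T X" "closedin T X" "X \<noteq> {}"
  shows "\<exists>C\<in>\<C>. \<exists>V. openin T V \<and> V \<noteq> {} \<and> V \<subseteq> C \<inter> X"
proof (rule ccontr)
  assume none: "\<not> ?thesis"
  have "T interior_of \<Union>((\<lambda>C. C \<inter> X) ` \<C>) = {}"
  proof (rule Baire_category_alt)
    show "completely_metrizable_space T \<or> locally_compact_space T \<and> regular_space T"
      using compact Hausdorff compact_Hausdorff_imp_regular_space compact_imp_locally_compact_space by blast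
    show "countable ((\<lambda>C. C \<inter> X) ` \<C>)" using C(1) by simp
    show "closedin T D \<and> T interior_of D = {}" if D: "D \<in> (\<lambda>C. C \<inter> X) ` \<C>" for D
    proof -
      obtain C where "C \<in> \<C>" "D = C \<inter> X" using D by blast
      then show ?thesis using none assms(2) X(2) unfolding interior_of_eq_empty by blast
    qed
  qed
  moreover have "\<Union>((\<lambda>C. C \<inter> X) ` \<C>) = X" using C(3) by blast
  moreover have "T interior_of X = X" using X(1) by (simp add: interior_of_eq)
  ultimately show False using X(3) by metis
qed

text \<open>
  Baire's theorem is applied to all of \<open>G\<close>, which yields \<open>N\<close>, and then to each coset of \<open>N\<close>, which yields an open
  member of the closed cover containing an element \<open>g\<close> of the coset; any normal subgroup \<open>M\<close> inside that member
  satisfies \<open>[M, g, \<dots>, g] = 1\<close>.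
\<close>

theorem open_upper_central_of_countable_nilpotent_cover:
  assumes cnt: "countable \<H>"
    and nilp: "\<And>H. H \<in> \<H> \<Longrightarrow> subgroup H G \<and> nilpotent_group (G\<lparr>carrier := H\<rparr>)"
    and cover: "\<Union>\<H> = carrier G"
  shows "\<exists>r. openin T (upper_central G r)"
proof -
  let ?IC = "iterated_centralizer G"
  have closed_one: "closedin T {\<one>}"
    using Hausdorff by (simp add: closedin_Hausdorff_sing_eq topspace_eq_carrier)
  define \<C> where "\<C> = (\<lambda>H. T closure_of H) ` \<H>"
  have C_subgroup: "subgroup C G" and C_closed: "closedin T C"
    and C_nilp: "\<exists>n. C \<subseteq> ?IC C {\<one>} n" if C: "C \<in> \<C>" for C
  proof -
    obtain H where H: "H \<in> \<H>" "C = T closure_of H" using C by (auto simp: \<C>_def)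
    then have sub: "subgroup H G" using nilp by blast
    then have HG: "H \<subseteq> carrier G" by (rule subgroup.subset)
    show "subgroup C G" unfolding H(2) using sub by (rule closure_of_subgroup)
    show "closedin T C" by (simp add: H(2))
    obtain n where "H \<subseteq> ?IC H {\<one>} n" using nilp[OF H(1)] nilpotent_subgroup_iff[OF sub] by blast
    then have "C \<subseteq> ?IC H {\<one>} n"
      unfolding H(2) using iterated_centralizer_closed[OF HG closed_one] by (rule closure_of_minimal)
    then show "\<exists>n. C \<subseteq> ?IC C {\<one>} n"
      unfolding H(2) iterated_centralizer_closure[OF HG closed_one] by blast
  qed
  have "countable \<C>" using cnt by (simp add: \<C>_def)
  have C_cover: "carrier G \<subseteq> \<Union>\<C>"
  proof
    fix x assume "x \<in> carrier G"
    then obtain H where "H \<in> \<H>" "x \<in> H" using cover by blast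
    moreover from this have "H \<subseteq> T closure_of H"
      using nilp by (intro closure_of_subset) (simp add: topspace_eq_carrier subgroup.subset)
    ultimately show "x \<in> \<Union>\<C>" by (auto simp: \<C>_def)
  qed
  have near: "\<exists>C\<in>\<C>. openin T C \<and> C \<inter> X \<noteq> {}"
    if X: "openin T X" "closedin T X" "X \<noteq> {}" for X
  proof -
    have "X \<subseteq> \<Union>\<C>" using C_cover openin_subset[OF X(1)] by (simp add: topspace_eq_carrier)
    then obtain C V where CV: "C \<in> \<C>" "openin T V" "V \<noteq> {}" "V \<subseteq> C \<inter> X"
      using baire_closed_cover[OF \<open>countable \<C>\<close> C_closed _ X] by blast
    then have "openin T C" using open_subgroup_of_interior[OF C_subgroup] by blast
    then show ?thesis using CV by blast
  qed
  have inner: "\<exists>N. N \<lhd> G \<and> openin T N \<and> N \<subseteq> C" if C: "C \<in> \<C>" "openin T C" for C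
    using exists_open_normal_subgroup[OF compact C(2) C_closed[OF C(1)]]
      subgroup.one_closed[OF C_subgroup[OF C(1)]] by blast
  obtain C where C: "C \<in> \<C>" "openin T C"
    using near[OF openin_topspace closedin_topspace] topspace_eq_carrier one_closed by blast
  then obtain N where N: "N \<lhd> G" "openin T N" "N \<subseteq> C" using inner by blast
  obtain c where "C \<subseteq> ?IC C {\<one>} c" using C_nilp[OF C(1)] by blast
  then have N_nilp: "N \<subseteq> ?IC N {\<one>} c"
    using N(3) iterated_centralizer_mono[OF N(3) subset_refl] by blast
  interpret N: normal N G by fact
  have fin: "finite (carrier (G Mod N))"
    using compact N(1,2) by (rule finite_quotient_of_open)
  have coset: "\<exists>g\<in>R. \<exists>M k. M \<lhd> G \<and> openin T M \<and> M \<subseteq> ?IC {g} {\<one>} k" if R: "R \<in> carrier (G Mod N)" for R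
  proof -
    obtain x where x: "x \<in> carrier G" "R = N #> x" using R by (auto simp: carrier_FactGroup)
    have "openin T R" "closedin T R"
      unfolding x(2) using N(2) N.subset x(1) open_subgroup_closed[OF N.subgroup_axioms]
      by (auto intro: open_coset closed_coset)
    moreover have "R \<noteq> {}" using rcos_self[OF x(1) N.subgroup_axioms] x(2) by blast
    ultimately obtain D g where D: "D \<in> \<C>" "openin T D" "g \<in> D" "g \<in> R" using near by blast
    obtain M where M: "M \<lhd> G" "openin T M" "M \<subseteq> D" using inner[OF D(1,2)] by blast
    obtain k where "D \<subseteq> ?IC D {\<one>} k" using C_nilp[OF D(1)] by blast
    then have "M \<subseteq> ?IC {g} {\<one>} k"
      using M(3) iterated_centralizer_mono[of "{g}" D "{\<one>}" "{\<one>}" k] D(3) by blast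
    then show ?thesis using D(4) M by blast
  qed
  (* Finitely many cosets are treated one after the other, intersecting the subgroups M. *)
  have uniform: "\<exists>M k. M \<lhd> G \<and> openin T M \<and> (\<forall>R\<in>\<R>. \<exists>g\<in>R. M \<subseteq> ?IC {g} {\<one>} k)"
    if "finite \<R>" "\<R> \<subseteq> carrier (G Mod N)" for \<R>
    using that
  proof (induction \<R>)
    case empty
    then show ?case using normal_carrier openin_topspace[of T] by (auto simp: topspace_eq_carrier)
  next
    case (insert R \<R>)
    then obtain M k where M: "M \<lhd> G" "openin T M" "\<forall>R\<in>\<R>. \<exists>g\<in>R. M \<subseteq> ?IC {g} {\<one>} k" by auto
    obtain g M' k' where M': "g \<in> R" "M' \<lhd> G" "openin T M'" "M' \<subseteq> ?IC {g} {\<one>} k'"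
      using coset insert.prems by blast
    have RG: "R' \<subseteq> carrier G" if R': "R' \<in> insert R \<R>" for R'
    proof -
      have "R' \<in> carrier (G Mod N)" using R' insert.prems by blast
      then obtain x where "x \<in> carrier G" "R' = N #> x"
        unfolding carrier_FactGroup by blast
      then show ?thesis using r_coset_subset_G[OF N.subset] by blast
    qed
    have "\<exists>h\<in>R'. M \<inter> M' \<subseteq> ?IC {h} {\<one>} (max k k')" if R': "R' \<in> insert R \<R>" for R'
    proof -
      have "\<exists>h\<in>R'. M \<inter> M' \<subseteq> ?IC {h} {\<one>} k \<or> M \<inter> M' \<subseteq> ?IC {h} {\<one>} k'"
        using R' M(3) M'(1,4) by blast
      then obtain h l where h: "h \<in> R'" "M \<inter> M' \<subseteq> ?IC {h} {\<one>} l" "l \<le> max k k'"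
        using max.cobounded1 max.cobounded2 by meson
      then have "M \<inter> M' \<subseteq> ?IC {h} {\<one>} (max k k')"
        using iterated_centralizer_one_increasing[of "{h}" l "max k k'"] RG[OF R'] by blast
      then show ?thesis using h(1) by blast
    qed
    then show ?case
      using M M' by (intro exI[of _ "M \<inter> M'"] exI[of _ "max k k'"]) (auto intro: normal_subgroup_intersect)
  qed
  then obtain M k where M: "M \<lhd> G" "openin T M"
      "\<forall>R\<in>carrier (G Mod N). \<exists>g\<in>R. M \<subseteq> ?IC {g} {\<one>} k"
    using fin by blast
  have "\<exists>r. N \<inter> M \<subseteq> upper_central G r"
  proof (rule unipotent_nilpotent_subset_upper_central[OF N(1) fin N_nilp])
    show "N \<inter> M \<lhd> G" "N \<inter> M \<subseteq> N" using N(1) M(1) normal_subgroup_intersect by blast+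
    show "\<exists>g\<in>N #> x. N \<inter> M \<subseteq> ?IC {g} {\<one>} k" if "x \<in> carrier G" for x
    proof -
      have "N #> x \<in> carrier (G Mod N)" using that by (simp add: carrier_FactGroup)
      then obtain g where g: "g \<in> N #> x" "M \<subseteq> ?IC {g} {\<one>} k" using M(3) by blast
      have "N \<inter> M \<subseteq> M" by (rule Int_lower2)
      with g show ?thesis by (meson subset_trans)
    qed
  qed
  moreover have "openin T (N \<inter> M)" using N(2) M(2) by (rule openin_Int)
  moreover have "N \<inter> M \<noteq> {}"
    using N.one_closed subgroup.one_closed[OF normal_imp_subgroup[OF M(1)]] by blast
  ultimately show ?thesis using open_upper_central_of_open_subset by blast
qed

text \<open>
  An open normal \<open>N\<close> with \<open>N \<inter> K = 1\<close> satisfies \<open>[N, G, \<dots>, G] \<subseteq> N \<inter> K = 1\<close>.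
\<close>

theorem open_upper_central_of_finite_by_nilpotent:
  assumes K: "finite K" "K \<lhd> G" and nilp: "nilpotent_group (G Mod K)"
  shows "\<exists>c. openin T (upper_central G c)"
proof -
  interpret K: normal K G by fact
  obtain c where c: "carrier G \<subseteq> iterated_centralizer G (carrier G) K c"
    using nilp nilpotent_quotient_iff[OF K(2)] by blast
  obtain N where N: "N \<lhd> G" "openin T N" "N \<inter> K \<subseteq> {\<one>}"
    using exists_open_normal_avoiding[OF K(1) K.subset] by blast
  have "N \<subseteq> N \<inter> iterated_centralizer G (carrier G) K c"
    using c subgroup.subset[OF normal_imp_subgroup[OF N(1)]] by blast
  also have "\<dots> \<subseteq> iterated_centralizer G (carrier G) (N \<inter> K) c"
    using N(1) by (rule normal_inter_iterated_centralizer) simp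
  also have "\<dots> \<subseteq> upper_central G c"
    unfolding upper_central_eq using N(3) by (intro iterated_centralizer_mono) auto
  finally have "N \<subseteq> upper_central G c" .
  moreover have "N \<noteq> {}" using subgroup.one_closed[OF normal_imp_subgroup[OF N(1)]] by blast
  ultimately show ?thesis using N(2) open_upper_central_of_open_subset by blast
qed

end

theorem theorem1p2:
  fixes G :: "('a, 'b) monoid_scheme" and T :: "'a topology"
  assumes "profinite_group G T"
  shows "((\<exists>\<H>. countable \<H>
              \<and> (\<forall>H \<in> \<H>. subgroup H G \<and> nilpotent_group (G\<lparr>carrier := H\<rparr>))
              \<and> \<Union>\<H> = carrier G)
          \<longleftrightarrow> (\<exists>K. finite K \<and> K \<lhd> G \<and> nilpotent_group (G Mod K)))
       \<and> ((\<exists>K. finite K \<and> K \<lhd> G \<and> nilpotent_group (G Mod K))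
          \<longleftrightarrow> (\<exists>m::nat. m > 0 \<and> openin T (upper_central G m)))"
    (is "(?cover \<longleftrightarrow> ?fbn) \<and> (?fbn \<longleftrightarrow> ?open)")
proof -
  interpret profinite_group G T by fact
  (* The third condition asks for a positive index, so an index 0 has to be raised. *)
  have positive: ?open if "openin T (upper_central G r)" for r
  proof -
    have "upper_central G r \<noteq> {}"
      using subgroup.one_closed[OF normal_imp_subgroup[OF upper_central_normal]] by blast
    then have "openin T (upper_central G (Suc r))"
      using that upper_central_increasing[of r "Suc r"] open_upper_central_of_open_subset
      by (meson le_SucI order_refl)
    then show ?thesis by blast
  qed
  have "?open" if c: ?cover
  proof -
    obtain \<H> where H: "countable \<H>"
        "\<forall>H\<in>\<H>. subgroup H G \<and> nilpotent_group (G\<lparr>carrier := H\<rparr>)" "\<Union>\<H> = carrier G"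
      using c by (elim exE conjE)
    obtain r where "openin T (upper_central G r)"
      using open_upper_central_of_countable_nilpotent_cover[OF H(1) bspec[OF H(2)] H(3)] ..
    then show ?thesis by (rule positive)
  qed
  moreover have "?open" if k: ?fbn
  proof -
    obtain K where K: "finite K" "K \<lhd> G" "nilpotent_group (G Mod K)"
      using k by (elim exE conjE)
    obtain r where "openin T (upper_central G r)"
      using open_upper_central_of_finite_by_nilpotent[OF K] ..
    then show ?thesis by (rule positive)
  qed
  moreover have "?fbn \<and> ?cover" if m: ?open
  proof -
    obtain m where "openin T (upper_central G m)" using m by blast
    then have fin: "finite (carrier (G Mod upper_central G m))"
      using finite_quotient_of_open[OF compact upper_central_normal] by blast
    obtain \<H> where H: "finite \<H>"
        "\<forall>H\<in>\<H>. subgroup H G \<and> nilpotent_group (G\<lparr>carrier := H\<rparr>)" "\<Union>\<H> = carrier G"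
      using finite_nilpotent_cover_of_finite_index_upper_central[OF fin] by (elim exE conjE)
    show ?thesis
      using finite_by_nilpotent_of_finite_index_upper_central[OF fin] countable_finite[OF H(1)] H(2,3)
      by (intro conjI exI[of _ \<H>])
  qed
  ultimately show ?thesis by argo
qed

end
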